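(* For every integer $t\geq0$, the graph $\widehat B_t^\bullet$ is connected and cubic, and satisfies $$|V(\widehat B_t^\bullet)|=108\cdot2^t-14,\qquad \gamma(\widehat B_t^\bullet)=34\cdot2^t-4,\qquad \rho(\widehat B_t^\bullet)=16\cdot2^t-2.$$ Consequently, $$\gamma(\widehat B_t^\bullet)-2\rho(\widehat B_t^\bullet)=2^{t+1},$$ and $$\frac{\gamma(\widehat B_t^\bullet)}{\rho(\widehat B_t^\bullet)}=\frac{17}{8}+\frac{1}{64\cdot2^t-8}\xrightarrow[t\to\infty]{}\frac{17}{8}.$$
   Context: All graphs are finite, simple and undirected. Cubic means every vertex has degree $3$. $\gamma(G)$ is the domination number (minimum size of $D\subseteq V(G)$ meeting every closed neighborhood). $\rho(G)$ is the packing number (maximum size of a set of vertices pairwise at distance at least $3$). A rooted graph $(H,x)$ is a graph $H$ with a distinguished vertex $x$. Operations on vertex-disjoint rooted graphs (when the same graph occurs twice, take disjoint copies): - Pendant-root extension $(H^\uparrow,p)$: add a new vertex $p$ and the edge $px$; the new root is $p$. - Rooted join $(H\odot K,r)$ of $(H,x)$ and $(K,y)$: identify $x$ and $y$ to a common root $r$. - $H^{\Join}:=H^\uparrow\odot H^\uparrow$. - Connector composition: for a connected rooted graph $(K,y)$ with an ordered pair $(z_1,z_2)$ of distinct vertices of $V(K)\setminus\{y\}$ (child ports), and rooted graphs $(H_1,x_1),(H_2,x_2)$, all vertex-disjoint, $(H_1\circledast_K H_2,y)$ is the rooted graph obtained from the disjoint union of $K,H_1,H_2$ by adding the edges $z_1x_1$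 and $z_2x_2$; its root is $y$. - Closure: $\widehat H$ is the unrooted graph obtained from two disjoint copies $(H_L,x_L),(H_R,x_R)$ of $(H,x)$ by adding the edge $x_Lx_R$. The seed $(B,b)$: $B$ is the graph obtained from the cycle $b_1b_2\cdots b_9b_1$ by adding the edges $b_2b_6,\ b_3b_8,\ b_4b_7,\ b_5b_9$; its root is $b=b_1$. The connector $S$: $S=B-b_4b_7$ (delete the edge $b_4b_7$), root $b=b_1$, ordered child ports $(b_4,b_7)$. The connector $R$: let $A$ be obtained from the cycle $a_1a_2a_3a_4a_5a_1$ by adding a vertex $a_6$ and the edges $a_3a_6,\ a_5a_6$. $R$ is obtained from $A$ by subdividing the edge $a_3a_4$ with a new vertex $a_7$ and adding the edge $a_2a_7$; root $a=a_1$, ordered child ports $(a_4,a_6)$. Define rooted graphs $B_0^\bullet:=B^{\Join}\circledast_S B^{\Join}$ and $B_{t+1}^\bullet:=B_t^\bullet\circledast_R B_t^\bullet$ for $t\ge0$. $\widehat B_t^\bullet$ is the closure of $B_t^\bullet$. *)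

theory Defs
  imports Complex_Main "Graph_Theory.Graph_Theory"
begin

text \<open>
  A finite simple undirected graph is a \<^locale>\<open>pair_graph\<close>: an undirected edge is the pair of
  its two orientations, and in particular degrees are out-degrees.
\<close>

definition cubic :: "'a pair_pre_digraph \<Rightarrow> bool" where
  "cubic G \<longleftrightarrow> (\<forall>v \<in> pverts G. out_degree (with_proj G) v = 3)"

definition closed_nbhd :: "'a pair_pre_digraph \<Rightarrow> 'a \<Rightarrow> 'a set" where
  "closed_nbhd G v = insert v {w. (v, w) \<in> parcs G}"

definition dominating :: "'a pair_pre_digraph \<Rightarrow> 'a set \<Rightarrow> bool" where
  "dominating G D \<longleftrightarrow> D \<subseteq> pverts G \<and> (\<forall>v \<in> pverts G. D \<inter> closed_nbhd G v \<noteq> {})"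

definition domination_number :: "'a pair_pre_digraph \<Rightarrow> nat" where
  "domination_number G = Min (card ` {D. dominating G D})"

text \<open>
  The graph distance is the shortest-path length for unit edge weights; it is \<open>\<infinity>\<close> between
  different components.
\<close>

definition graph_dist :: "'a pair_pre_digraph \<Rightarrow> 'a \<Rightarrow> 'a \<Rightarrow> ereal" where
  "graph_dist G u v = wf_digraph.\<mu> (with_proj G) (\<lambda>_. 1) u v"

definition packing :: "'a pair_pre_digraph \<Rightarrow> 'a set \<Rightarrow> bool" where
  "packing G P \<longleftrightarrow> P \<subseteq> pverts G \<and> (\<forall>u \<in> P. \<forall>v \<in> P. u \<noteq> v \<longrightarrow> 3 \<le> graph_dist G u v)"

definition packing_number :: "'a pair_pre_digraph \<Rightarrow> nat" where
  "packing_number G = Max (card ` {P. packing G P})"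

definition relabel :: "('a \<Rightarrow> 'b) \<Rightarrow> 'a pair_pre_digraph \<Rightarrow> 'b pair_pre_digraph" where
  "relabel f G = \<lparr> pverts = f ` pverts G, parcs = map_prod f f ` parcs G \<rparr>"

definition graph_union ::
  "'a pair_pre_digraph \<Rightarrow> 'a pair_pre_digraph \<Rightarrow> 'a pair_pre_digraph" where
  "graph_union G H = \<lparr> pverts = pverts G \<union> pverts H, parcs = parcs G \<union> parcs H \<rparr>"

definition add_edge :: "'a \<Rightarrow> 'a \<Rightarrow> 'a pair_pre_digraph \<Rightarrow> 'a pair_pre_digraph" where
  "add_edge u v G = G \<lparr> parcs := parcs G \<union> {(u, v), (v, u)} \<rparr>"

definition del_edge :: "'a \<Rightarrow> 'a \<Rightarrow> 'a pair_pre_digraph \<Rightarrow> 'a pair_pre_digraph" where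
  "del_edge u v G = G \<lparr> parcs := parcs G - {(u, v), (v, u)} \<rparr>"

record 'a rooted =
  rgraph :: "'a pair_pre_digraph"
  rroot :: 'a

record 'a connector = "'a rooted" +
  port1 :: 'a
  port2 :: 'a

text \<open>
  The operations below act on graphs whose vertices are words over the natural numbers. Putting
  a letter in front of every vertex yields a copy; copies for different letters are disjoint, and
  none of them contains the empty word. Thus every operation first makes its arguments
  vertex-disjoint, even when they are equal.
\<close>

definition copy :: "nat \<Rightarrow> nat list pair_pre_digraph \<Rightarrow> nat list pair_pre_digraph" where
  "copy i = relabel ((#) i)"

text \<open>Pendant-root extension; the new root is the empty word.\<close>

definition pendant :: "nat list rooted \<Rightarrow> nat list rooted" where
  "pendant H =
    (let G = copy 0 (rgraph H)
     in \<lparr> rgraph = add_edge [] (0 # rroot H) (G \<lparr> pverts := insert [] (pverts G) \<rparr>),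
          rroot = [] \<rparr>)"

text \<open>Rooted join: the root of the copy of \<open>K\<close> is renamed to that of the copy of \<open>H\<close>.\<close>

definition rooted_join :: "nat list rooted \<Rightarrow> nat list rooted \<Rightarrow> nat list rooted" where
  "rooted_join H K =
    \<lparr> rgraph = graph_union (copy 0 (rgraph H))
        (relabel (\<lambda>v. if v = rroot K then 0 # rroot H else 1 # v) (rgraph K)),
      rroot = 0 # rroot H \<rparr>"

definition bowtie :: "nat list rooted \<Rightarrow> nat list rooted" where
  "bowtie H = rooted_join (pendant H) (pendant H)"

definition connector_comp ::
  "nat list connector \<Rightarrow> nat list rooted \<Rightarrow> nat list rooted \<Rightarrow> nat list rooted" where
  "connector_comp K H1 H2 =
    \<lparr> rgraph =
        add_edge (0 # port1 K) (1 # rroot H1)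
          (add_edge (0 # port2 K) (2 # rroot H2)
            (graph_union (copy 0 (rgraph K))
              (graph_union (copy 1 (rgraph H1)) (copy 2 (rgraph H2))))),
      rroot = 0 # rroot K \<rparr>"

definition closure_graph :: "nat list rooted \<Rightarrow> nat list pair_pre_digraph" where
  "closure_graph H =
    add_edge (0 # rroot H) (1 # rroot H)
      (graph_union (copy 0 (rgraph H)) (copy 1 (rgraph H)))"

text \<open>
  The concrete graphs are first given on numbers, \<open>i\<close> standing for \<open>b\<^sub>i\<close> or \<open>a\<^sub>i\<close>; the
  vertex \<open>i\<close> then becomes the one-letter word \<open>[i]\<close>.
\<close>

abbreviation letters :: "nat pair_pre_digraph \<Rightarrow> nat list pair_pre_digraph" where
  "letters \<equiv> relabel (\<lambda>i. [i])"

definition graph_B :: "nat pair_pre_digraph" where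
  "graph_B =
    \<lparr> pverts = {1..9},
      parcs = symcl {(1,2), (2,3), (3,4), (4,5), (5,6), (6,7), (7,8), (8,9), (9,1),
                     (2,6), (3,8), (4,7), (5,9)} \<rparr>"

definition graph_A :: "nat pair_pre_digraph" where
  "graph_A =
    \<lparr> pverts = {1..6},
      parcs = symcl {(1,2), (2,3), (3,4), (4,5), (5,1), (3,6), (5,6)} \<rparr>"

definition seed_B :: "nat list rooted" where
  "seed_B = \<lparr> rgraph = letters graph_B, rroot = [1] \<rparr>"

definition connector_S :: "nat list connector" where
  "connector_S =
    \<lparr> rgraph = letters (del_edge 4 7 graph_B), rroot = [1], port1 = [4], port2 = [7] \<rparr>"

definition connector_R :: "nat list connector" where
  "connector_R =
    \<lparr> rgraph = letters (add_edge 2 7 (subdivide graph_A (3, 4) 7)),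
      rroot = [1], port1 = [4], port2 = [6] \<rparr>"

primrec Bdot :: "nat \<Rightarrow> nat list rooted" where
  "Bdot 0 = connector_comp connector_S (bowtie seed_B) (bowtie seed_B)"
| "Bdot (Suc t) = connector_comp connector_R (Bdot t) (Bdot t)"

definition Bhat :: "nat \<Rightarrow> nat list pair_pre_digraph" where
  "Bhat t = closure_graph (Bdot t)"

end

theory Submission
  imports Defs
begin

text \<open>
Everything rests on one phenomenon: for the rooted graphs \<open>B\<^sub>t\<close> of the sequence, neither the
domination number nor the packing number reacts to what happens at the root. Precisely, with
\<open>k = 17 \<cdot> 2\<^sup>t - 2\<close>, there is a dominating set of size \<open>k\<close>, yet even a set that is
allowed to leave the root undominated has at least \<open>k\<close> vertices; and with
\<open>m = 8 \<cdot> 2\<^sup>t - 1\<close>, no packing has more than \<open>m\<close> vertices, yet some packing of size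
\<open>m\<close> avoids the root. This is called rigidity below.

If two rigid graphs are hung at the ports of a connector, a port can do no more for its child than
dominate the child's root, which saves nothing, and the most that a child can do for its port is to
dominate it. So the cost of the composition is \<open>2k\<close> plus the number of vertices that the
connector needs when root and ports are excused. For \<open>R\<close> this number is 2, because no vertex
dominates \<open>a\<^sub>2\<close>, \<open>a\<^sub>3\<close> and \<open>a\<^sub>5\<close> at once, and it is attained by
\<open>{a\<^sub>2, a\<^sub>5}\<close>, which even dominates all of \<open>R\<close>. Dually any two vertices of \<open>R\<close> lie
in a common closed neighbourhood, so \<open>R\<close> contributes at most one vertex to a packing, and
\<open>a\<^sub>2\<close>, which is no neighbour of a port, can always be added. This gives the recursions
\<open>k \<mapsto> 2k + 2\<close> and \<open>m \<mapsto> 2m + 1\<close>, and rigidity is inherited. The closure of a rigid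
graph doubles both parameters.

The start \<open>t = 0\<close> comes from two finite facts about the seed \<open>B\<close>. No two vertices dominate all of
\<open>B\<close> except possibly its root; and any two vertices of \<open>B\<close> other than the root lie in a common closed
neighbourhood, so a packing has at most one vertex besides the root. For the bowtie of \<open>B\<close> they
yield that a set dominating it off its root \<open>r\<close> has at least 6 vertices, and at least 7 if it contains
\<open>r\<close>, and that a packing has at most 2 vertices, and at most 3 if it dominates \<open>r\<close>. For \<open>S\<close>, adding to \<open>D\<close> those ports that the children
dominate gives a set dominating \<open>B\<close> off its root, so \<open>S\<close> together with the surplus of the
two children costs at least 3, in total \<open>3 + 6 + 6 = 15\<close>. And in \<open>S\<close> a packing has at most one vertex
besides the ports, while a port in the packing costs the corresponding child its surplus, in total
\<open>1 + 3 + 3 = 7\<close>.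
\<close>

(* The letter 1 marks a copy, so it has to remain a numeral: after rewriting it to Suc 0 the
   neighbourhood equations for the words 1 # v would no longer apply. *)
declare One_nat_def [simp del]

section \<open>Neighbourhoods in relabelled and combined graphs\<close>

definition nbrs :: "'a pair_pre_digraph \<Rightarrow> 'a \<Rightarrow> 'a set" where
  "nbrs G v = {w. (v, w) \<in> parcs G}"

lemma closed_nbhd_nbrs: "closed_nbhd G v = insert v (nbrs G v)"
  by (simp add: closed_nbhd_def nbrs_def)

lemma pverts_simps [simp]:
  "pverts (relabel f G) = f ` pverts G"
  "pverts (graph_union G H) = pverts G \<union> pverts H"
  "pverts (add_edge u v G) = pverts G"
  "pverts (copy i G') = (#) i ` pverts G'"
  by (simp_all add: relabel_def graph_union_def add_edge_def copy_def)

lemma nbrs_relabel_iff: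
  "w \<in> nbrs (relabel f G) v \<longleftrightarrow> (\<exists>a b. v = f a \<and> w = f b \<and> b \<in> nbrs G a)"
  by (auto simp: nbrs_def relabel_def)

lemma nbrs_relabel: "inj f \<Longrightarrow> nbrs (relabel f G) (f v) = f ` nbrs G v"
  by (auto simp: nbrs_relabel_iff inj_eq)

lemma nbrs_relabel_outside: "w \<notin> range f \<Longrightarrow> nbrs (relabel f G) w = {}"
  by (auto simp: nbrs_def relabel_def)

lemma nbrs_copy: "nbrs (copy i G) (j # v) = (if j = i then (#) i ` nbrs G v else {})"
  by (auto simp: nbrs_def copy_def relabel_def)

lemma nbrs_copy_Nil: "nbrs (copy i G) [] = {}"
  by (auto simp: nbrs_def copy_def relabel_def)

lemma nbrs_graph_union: "nbrs (graph_union G H) v = nbrs G v \<union> nbrs H v"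
  by (auto simp: nbrs_def graph_union_def)

lemma nbrs_add_edge:
  "nbrs (add_edge a b G) v =
     nbrs G v \<union> (if v = a then {b} else {}) \<union> (if v = b then {a} else {})"
  by (auto simp: nbrs_def add_edge_def)

lemma nbrs_insert_vertex: "nbrs (G\<lparr>pverts := V\<rparr>) v = nbrs G v"
  by (simp add: nbrs_def)

lemmas nbrs_simps = nbrs_copy nbrs_copy_Nil nbrs_graph_union nbrs_add_edge nbrs_insert_vertex

lemma nbrs_del_edge:
  "nbrs (del_edge a b G) v = nbrs G v - (if v = a then {b} else {}) - (if v = b then {a} else {})"
  by (auto simp: nbrs_def del_edge_def)

lemma pverts_del_edge: "pverts (del_edge a b G) = pverts G"
  by (simp add: del_edge_def)

lemma pair_graph_iff:
  "pair_graph G \<longleftrightarrow> finite (pverts G) \<and>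
     (\<forall>v w. w \<in> nbrs G v \<longrightarrow> v \<in> pverts G \<and> w \<in> pverts G \<and> v \<noteq> w \<and> v \<in> nbrs G w)"
  (is "?L \<longleftrightarrow> ?R")
proof
  assume ?L
  then interpret pair_graph G .
  show ?R
    using pair_finite_verts by (auto simp: nbrs_def dest: in_arcsD1 in_arcsD2 pair_no_loops arcs_symmetric)
next
  assume r: ?R
  then have "parcs G \<subseteq> pverts G \<times> pverts G"
    by (auto simp: nbrs_def)
  with r have "finite (parcs G)"
    by (meson finite_SigmaI finite_subset)
  with r show ?L
    by unfold_locales (auto simp: nbrs_def symmetric_def sym_def)
qed

lemma finite_nbrs: "pair_graph G \<Longrightarrow> finite (nbrs G v)"
  by (rule finite_subset[of _ "pverts G"]) (auto simp: pair_graph_iff)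

lemma nbrs_subset: "pair_graph G \<Longrightarrow> nbrs G v \<subseteq> pverts G"
  by (auto simp: pair_graph_iff)

lemma pair_graph_relabel: "inj f \<Longrightarrow> pair_graph G \<Longrightarrow> pair_graph (relabel f G)"
  by (simp add: pair_graph_iff nbrs_relabel_iff) (metis injD imageI)

lemma pair_graph_copy: "pair_graph G \<Longrightarrow> pair_graph (copy i G)"
  by (simp add: copy_def pair_graph_relabel)

lemma pair_graph_graph_union: "pair_graph G \<Longrightarrow> pair_graph H \<Longrightarrow> pair_graph (graph_union G H)"
  by (auto simp: pair_graph_iff nbrs_graph_union)

lemma pair_graph_add_edge:
  "pair_graph G \<Longrightarrow> a \<in> pverts G \<Longrightarrow> b \<in> pverts G \<Longrightarrow> a \<noteq> b \<Longrightarrow> pair_graph (add_edge a b G)"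
  by (auto simp: pair_graph_iff nbrs_add_edge split: if_splits)

lemma pair_graph_insert_vertex:
  "pair_graph G \<Longrightarrow> pair_graph (G\<lparr>pverts := insert v (pverts G)\<rparr>)"
  by (auto simp: pair_graph_iff nbrs_insert_vertex)

lemma pair_graph_del_edge: "pair_graph G \<Longrightarrow> pair_graph (del_edge a b G)"
  by (auto simp: pair_graph_iff nbrs_del_edge pverts_del_edge)

section \<open>The rooted operations\<close>

lemma pverts_connector_comp:
  "pverts (rgraph (connector_comp K H1 H2)) =
     (#) 0 ` pverts (rgraph K) \<union> (#) 1 ` pverts (rgraph H1) \<union> (#) 2 ` pverts (rgraph H2)"
  by (auto simp: connector_comp_def)

lemma rroot_connector_comp: "rroot (connector_comp K H1 H2) = 0 # rroot K"
  by (simp add: connector_comp_def)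

lemma nbrs_connector_comp:
  "nbrs (rgraph (connector_comp K H1 H2)) (0 # v) = (#) 0 ` nbrs (rgraph K) v
     \<union> (if v = port1 K then {1 # rroot H1} else {}) \<union> (if v = port2 K then {2 # rroot H2} else {})"
  "nbrs (rgraph (connector_comp K H1 H2)) (1 # v) = (#) 1 ` nbrs (rgraph H1) v
     \<union> (if v = rroot H1 then {0 # port1 K} else {})"
  "nbrs (rgraph (connector_comp K H1 H2)) (2 # v) = (#) 2 ` nbrs (rgraph H2) v
     \<union> (if v = rroot H2 then {0 # port2 K} else {})"
  by (auto simp: connector_comp_def nbrs_simps)

lemma closed_nbhd_connector_comp:
  "closed_nbhd (rgraph (connector_comp K H1 H2)) (0 # v) = (#) 0 ` closed_nbhd (rgraph K) v
     \<union> (if v = port1 K then {1 # rroot H1} else {}) \<union> (if v = port2 K then {2 # rroot H2} else {})"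
  "closed_nbhd (rgraph (connector_comp K H1 H2)) (1 # v) = (#) 1 ` closed_nbhd (rgraph H1) v
     \<union> (if v = rroot H1 then {0 # port1 K} else {})"
  "closed_nbhd (rgraph (connector_comp K H1 H2)) (2 # v) = (#) 2 ` closed_nbhd (rgraph H2) v
     \<union> (if v = rroot H2 then {0 # port2 K} else {})"
  by (auto simp: closed_nbhd_nbrs nbrs_connector_comp)

lemma pverts_bowtie:
  "pverts (rgraph (bowtie H)) =
     insert [0] ((\<lambda>v. 0 # 0 # v) ` pverts (rgraph H) \<union> (\<lambda>v. 1 # 0 # v) ` pverts (rgraph H))"
  by (auto simp: bowtie_def rooted_join_def pendant_def image_image)

lemma rroot_bowtie: "rroot (bowtie H) = [0]"
  by (simp add: bowtie_def rooted_join_def pendant_def)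

lemma nbrs_pendant:
  "nbrs (rgraph (pendant H)) [] = {0 # rroot H}"
  "nbrs (rgraph (pendant H)) (0 # v) =
     (#) 0 ` nbrs (rgraph H) v \<union> (if v = rroot H then {[]} else {})"
  by (auto simp: pendant_def nbrs_simps)

lemma nbrs_bowtie:
  "nbrs (rgraph (bowtie H)) [0] = {0 # 0 # rroot H, 1 # 0 # rroot H}"
  "nbrs (rgraph (bowtie H)) (0 # 0 # v) = (\<lambda>v. 0 # 0 # v) ` nbrs (rgraph H) v
     \<union> (if v = rroot H then {[0]} else {})"
  "nbrs (rgraph (bowtie H)) (1 # 0 # v) = (\<lambda>v. 1 # 0 # v) ` nbrs (rgraph H) v
     \<union> (if v = rroot H then {[0]} else {})"
proof -
  \<comment> \<open>the renaming that the rooted join applies to its second argument\<close>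
  define f :: "nat list \<Rightarrow> nat list" where "f v = (if v = [] then [0] else 1 # v)" for v
  have inj: "inj f" by (auto simp: inj_def f_def split: if_splits)
  have G: "rgraph (bowtie H) = graph_union (copy 0 (rgraph (pendant H))) (relabel f (rgraph (pendant H)))"
  proof -
    have "f = (\<lambda>v. if v = rroot (pendant H) then 0 # rroot (pendant H) else 1 # v)"
      by (auto simp: f_def pendant_def fun_eq_iff)
    then show ?thesis
      by (simp add: bowtie_def rooted_join_def)
  qed
  have f: "f [] = [0]" "f (0 # v) = 1 # 0 # v" for v by (simp_all add: f_def)
  have 0: "nbrs (relabel f (rgraph (pendant H))) [0] = {1 # 0 # rroot H}"
    using nbrs_relabel[OF inj, of "rgraph (pendant H)" "[]"] by (simp add: f nbrs_pendant)
  have 1: "nbrs (relabel f (rgraph (pendant H))) (0 # 0 # v) = {}" for v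
    by (rule nbrs_relabel_outside) (auto simp: f_def split: if_splits)
  have 2: "nbrs (relabel f (rgraph (pendant H))) (1 # 0 # v) = (\<lambda>v. 1 # 0 # v) ` nbrs (rgraph H) v
     \<union> (if v = rroot H then {[0]} else {})" for v
    using nbrs_relabel[OF inj, of "rgraph (pendant H)" "0 # v"]
    by (simp add: f nbrs_pendant image_Un image_image)
  show "nbrs (rgraph (bowtie H)) [0] = {0 # 0 # rroot H, 1 # 0 # rroot H}"
    "nbrs (rgraph (bowtie H)) (0 # 0 # v) = (\<lambda>v. 0 # 0 # v) ` nbrs (rgraph H) v
     \<union> (if v = rroot H then {[0]} else {})"
    "nbrs (rgraph (bowtie H)) (1 # 0 # v) = (\<lambda>v. 1 # 0 # v) ` nbrs (rgraph H) v
     \<union> (if v = rroot H then {[0]} else {})"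
    by (auto simp: G nbrs_simps 0 1 2 nbrs_pendant)
qed

lemma closed_nbhd_bowtie:
  "closed_nbhd (rgraph (bowtie H)) [0] = {[0], 0 # 0 # rroot H, 1 # 0 # rroot H}"
  "closed_nbhd (rgraph (bowtie H)) (0 # 0 # v) = (\<lambda>v. 0 # 0 # v) ` closed_nbhd (rgraph H) v
     \<union> (if v = rroot H then {[0]} else {})"
  "closed_nbhd (rgraph (bowtie H)) (1 # 0 # v) = (\<lambda>v. 1 # 0 # v) ` closed_nbhd (rgraph H) v
     \<union> (if v = rroot H then {[0]} else {})"
  by (auto simp: closed_nbhd_nbrs nbrs_bowtie)

lemma pverts_closure_graph:
  "pverts (closure_graph H) = (#) 0 ` pverts (rgraph H) \<union> (#) 1 ` pverts (rgraph H)"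
  by (simp add: closure_graph_def)

lemma nbrs_closure_graph:
  "nbrs (closure_graph H) (0 # v) = (#) 0 ` nbrs (rgraph H) v
     \<union> (if v = rroot H then {1 # rroot H} else {})"
  "nbrs (closure_graph H) (1 # v) = (#) 1 ` nbrs (rgraph H) v
     \<union> (if v = rroot H then {0 # rroot H} else {})"
  by (auto simp: closure_graph_def nbrs_simps)

lemma closed_nbhd_closure_graph:
  "closed_nbhd (closure_graph H) (0 # v) = (#) 0 ` closed_nbhd (rgraph H) v
     \<union> (if v = rroot H then {1 # rroot H} else {})"
  "closed_nbhd (closure_graph H) (1 # v) = (#) 1 ` closed_nbhd (rgraph H) v
     \<union> (if v = rroot H then {0 # rroot H} else {})"
  by (auto simp: closed_nbhd_nbrs nbrs_closure_graph)

lemma card_Un_image_disjoint: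
  assumes "finite A" "finite B" "inj f" "inj g" "range f \<inter> range g = {}"
  shows "card (f ` A \<union> g ` B) = card A + card B"
proof -
  have "f ` A \<inter> g ` B = {}" using assms(5) by auto
  then show ?thesis
    using assms by (simp add: card_Un_disjoint card_image inj_on_subset[of _ UNIV])
qed

lemma card_Un_copies:
  assumes "finite A" "finite B"
  shows "card ((#) (0 :: nat) ` A \<union> (#) 1 ` B) = card A + card B"
  by (rule card_Un_image_disjoint) (use assms in \<open>auto simp: inj_def\<close>)

lemma card_Un_copies3:
  assumes "finite A" "finite B" "finite C"
  shows "card ((#) (0 :: nat) ` A \<union> (#) 1 ` B \<union> (#) 2 ` C) = card A + card B + card C"
proof -
  have "((#) (0 :: nat) ` A \<union> (#) 1 ` B) \<inter> (#) 2 ` C = {}"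
    by auto
  then show ?thesis
    using assms by (simp add: card_Un_disjoint card_Un_copies card_image)
qed

lemma card_pverts_connector_comp:
  assumes "finite (pverts (rgraph K))" "finite (pverts (rgraph H1))" "finite (pverts (rgraph H2))"
  shows "card (pverts (rgraph (connector_comp K H1 H2)))
    = card (pverts (rgraph K)) + card (pverts (rgraph H1)) + card (pverts (rgraph H2))"
  unfolding pverts_connector_comp by (rule card_Un_copies3[OF assms])

section \<open>Connectedness and degrees\<close>

text \<open>
Connectedness as an induction principle, with sets closed under taking neighbours in place of paths:
in this form it passes from the pieces of a graph to the whole without any handling of walks.
\<close>

definition root_connected :: "'a pair_pre_digraph \<Rightarrow> 'a \<Rightarrow> bool" where
  "root_connected G r \<longleftrightarrow> (\<forall>S. r \<in> S \<longrightarrow> (\<forall>v \<in> S. nbrs G v \<subseteq> S) \<longrightarrow> pverts G \<subseteq> S)"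

text \<open>
The root lacks one edge, which it receives when it is joined to a vertex outside the graph.
\<close>

definition cubic_rooted :: "nat list rooted \<Rightarrow> bool" where
  "cubic_rooted H \<longleftrightarrow> pair_graph (rgraph H) \<and> rroot H \<in> pverts (rgraph H)
     \<and> root_connected (rgraph H) (rroot H)
     \<and> (\<forall>v \<in> pverts (rgraph H). card (nbrs (rgraph H) v) = (if v = rroot H then 2 else 3))"

definition cubic_connector :: "nat list connector \<Rightarrow> bool" where
  "cubic_connector K \<longleftrightarrow> pair_graph (rgraph K)
     \<and> {rroot K, port1 K, port2 K} \<subseteq> pverts (rgraph K)
     \<and> distinct [rroot K, port1 K, port2 K]
     \<and> root_connected (rgraph K) (rroot K)
     \<and> (\<forall>v \<in> pverts (rgraph K). card (nbrs (rgraph K) v)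
          = (if v \<in> {rroot K, port1 K, port2 K} then 2 else 3))"

text \<open>
The vertices reachable from the root form a set closed under neighbours, hence are all vertices;
symmetry of the edges then connects any two of them through the root.
\<close>

lemma connected_if_root_connected:
  assumes "pair_graph G" "r \<in> pverts G" "root_connected G r"
  shows "Digraph_Component.connected (with_proj G)"
proof -
  interpret pair_graph G by (rule assms)
  have reach: "r \<rightarrow>\<^sup>*\<^bsub>with_proj G\<^esub> v" if "v \<in> pverts G" for v
  proof -
    have "\<forall>v \<in> {v. r \<rightarrow>\<^sup>*\<^bsub>with_proj G\<^esub> v}. nbrs G v \<subseteq> {v. r \<rightarrow>\<^sup>*\<^bsub>with_proj G\<^esub> v}"
      by (auto simp: nbrs_def intro: reachable_adj_trans)
    moreover have "r \<in> {v. r \<rightarrow>\<^sup>*\<^bsub>with_proj G\<^esub> v}"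
      using assms(2) by auto
    ultimately show ?thesis
      using assms(3) that unfolding root_connected_def by blast
  qed
  have "u \<rightarrow>\<^sup>*\<^bsub>with_proj G\<^esub> v" if "u \<in> pverts G" "v \<in> pverts G" for u v
    using reach[OF that(1)] reach[OF that(2)] symmetric_reachable' reachable_trans by blast
  then show ?thesis
    using assms(2) reachable_mk_symmetricI by (auto simp: connected_def strongly_connected_def)
qed

lemma root_connected_mono:
  assumes "root_connected G r" "pverts H = pverts G" "\<And>v. nbrs G v \<subseteq> nbrs H v"
  shows "root_connected H r"
  unfolding root_connected_def
proof (intro allI impI)
  fix S
  assume "r \<in> S" "\<forall>v \<in> S. nbrs H v \<subseteq> S"
  then have "\<forall>v \<in> S. nbrs G v \<subseteq> S"
    using assms(3) by (meson subset_trans)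
  with \<open>r \<in> S\<close> show "pverts H \<subseteq> S"
    using assms(1,2) by (simp add: root_connected_def)
qed

text \<open>
How a closed set absorbs a whole piece of a larger graph: it suffices that it contains the image of
the root of the piece.
\<close>

lemma root_connected_image:
  assumes "root_connected H r" "f r \<in> S" "\<And>v. f v \<in> S \<Longrightarrow> f ` nbrs H v \<subseteq> S"
  shows "f ` pverts H \<subseteq> S"
  using assms(1)[unfolded root_connected_def, rule_format, of "f -` S"] assms(2,3) by auto

text \<open>
A closed set that contains the root swallows the connector, then by the port edges the roots of the
children, and then the children. Each of the two new edges raises the degree of a port and of a
child's root from 2 to 3.
\<close>

lemma cubic_rooted_connector_comp:
  assumes K: "cubic_connector K" and H1: "cubic_rooted H1" and H2: "cubic_rooted H2"
  shows "cubic_rooted (connector_comp K H1 H2)"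
proof -
  let ?C = "connector_comp K H1 H2"
  have "pair_graph (rgraph ?C)"
    using assms unfolding connector_comp_def cubic_rooted_def cubic_connector_def
    by (auto intro!: pair_graph_add_edge pair_graph_graph_union pair_graph_copy)
  moreover have "rroot ?C \<in> pverts (rgraph ?C)"
    using K by (auto simp: pverts_connector_comp rroot_connector_comp cubic_connector_def)
  moreover have "root_connected (rgraph ?C) (rroot ?C)"
    unfolding root_connected_def
  proof (intro allI impI)
    fix S
    assume root: "rroot ?C \<in> S" and closed: "\<forall>v \<in> S. nbrs (rgraph ?C) v \<subseteq> S"
    have 0: "(#) 0 ` pverts (rgraph K) \<subseteq> S"
      by (rule root_connected_image[where r = "rroot K"])
        (use K root closed[rule_format, of "0 # _"] in
          \<open>auto simp: cubic_connector_def rroot_connector_comp nbrs_connector_comp\<close>)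
    have "0 # port1 K \<in> S" "0 # port2 K \<in> S"
      using K 0 by (auto simp: cubic_connector_def)
    then have "1 # rroot H1 \<in> S" "2 # rroot H2 \<in> S"
      using closed by (force simp: nbrs_connector_comp)+
    have 1: "(#) 1 ` pverts (rgraph H1) \<subseteq> S"
      by (rule root_connected_image[where r = "rroot H1"])
        (use H1 \<open>1 # rroot H1 \<in> S\<close> closed[rule_format, of "1 # _"] in
          \<open>auto simp: cubic_rooted_def nbrs_connector_comp\<close>)
    have 2: "(#) 2 ` pverts (rgraph H2) \<subseteq> S"
      by (rule root_connected_image[where r = "rroot H2"])
        (use H2 \<open>2 # rroot H2 \<in> S\<close> closed[rule_format, of "2 # _"] in
          \<open>auto simp: cubic_rooted_def nbrs_connector_comp\<close>)
    show "pverts (rgraph ?C) \<subseteq> S"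
      using 0 1 2 by (simp add: pverts_connector_comp)
  qed
  moreover have "card (nbrs (rgraph ?C) v) = (if v = rroot ?C then 2 else 3)"
    if "v \<in> pverts (rgraph ?C)" for v
    using that assms finite_nbrs[of "rgraph K"] finite_nbrs[of "rgraph H1"] finite_nbrs[of "rgraph H2"]
    unfolding cubic_rooted_def cubic_connector_def
    by (auto simp: pverts_connector_comp rroot_connector_comp nbrs_connector_comp card_image
        card_insert_if image_iff split: if_splits)
  ultimately show ?thesis
    by (simp add: cubic_rooted_def)
qed

lemma cubic_rooted_bowtie:
  assumes "cubic_rooted H"
  shows "cubic_rooted (bowtie H)"
proof -
  let ?J = "bowtie H"
  have "pair_graph (rgraph (pendant H))"
    using assms unfolding pendant_def cubic_rooted_def Let_def
    by (auto intro!: pair_graph_add_edge pair_graph_insert_vertex[of "copy 0 (rgraph H)", simplified]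
        pair_graph_copy)
  then have "pair_graph (rgraph ?J)"
    unfolding bowtie_def rooted_join_def
    by (auto intro!: pair_graph_graph_union pair_graph_copy pair_graph_relabel simp: inj_def pendant_def)
  moreover have "rroot ?J \<in> pverts (rgraph ?J)"
    by (simp add: pverts_bowtie rroot_bowtie)
  moreover have "root_connected (rgraph ?J) (rroot ?J)"
    unfolding root_connected_def
  proof (intro allI impI)
    fix S
    assume root: "rroot ?J \<in> S" and closed: "\<forall>v \<in> S. nbrs (rgraph ?J) v \<subseteq> S"
    then have r: "0 # 0 # rroot H \<in> S" "1 # 0 # rroot H \<in> S"
      by (force simp: rroot_bowtie nbrs_bowtie)+
    have 0: "(\<lambda>v. 0 # 0 # v) ` pverts (rgraph H) \<subseteq> S"
      by (rule root_connected_image[where r = "rroot H"])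
        (use assms r closed[rule_format, of "0 # 0 # _"] in \<open>auto simp: cubic_rooted_def nbrs_bowtie\<close>)
    have 1: "(\<lambda>v. 1 # 0 # v) ` pverts (rgraph H) \<subseteq> S"
      by (rule root_connected_image[where r = "rroot H"])
        (use assms r closed[rule_format, of "1 # 0 # _"] in \<open>auto simp: cubic_rooted_def nbrs_bowtie\<close>)
    show "pverts (rgraph ?J) \<subseteq> S"
      using 0 1 root by (simp add: pverts_bowtie rroot_bowtie)
  qed
  moreover have "card (nbrs (rgraph ?J) v) = (if v = rroot ?J then 2 else 3)"
    if "v \<in> pverts (rgraph ?J)" for v
    using that assms finite_nbrs[of "rgraph H"]
    unfolding cubic_rooted_def
    by (auto simp: pverts_bowtie rroot_bowtie nbrs_bowtie card_image inj_on_def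
        card_insert_if image_iff split: if_splits)
  ultimately show ?thesis
    by (simp add: cubic_rooted_def)
qed

lemma closure_graph_cubic:
  assumes "cubic_rooted H"
  shows "pair_graph (closure_graph H)" "Digraph_Component.connected (with_proj (closure_graph H))"
    "cubic (closure_graph H)"
proof -
  let ?C = "closure_graph H"
  show pg: "pair_graph ?C"
    using assms unfolding closure_graph_def cubic_rooted_def
    by (auto intro!: pair_graph_add_edge pair_graph_graph_union pair_graph_copy)
  have "root_connected ?C (0 # rroot H)"
    unfolding root_connected_def
  proof (intro allI impI)
    fix S
    assume root: "0 # rroot H \<in> S" and closed: "\<forall>v \<in> S. nbrs ?C v \<subseteq> S"
    then have r: "1 # rroot H \<in> S"
      by (force simp: nbrs_closure_graph)
    have 0: "(#) 0 ` pverts (rgraph H) \<subseteq> S"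
      by (rule root_connected_image[where r = "rroot H"])
        (use assms root closed[rule_format, of "0 # _"] in \<open>auto simp: cubic_rooted_def nbrs_closure_graph\<close>)
    have 1: "(#) 1 ` pverts (rgraph H) \<subseteq> S"
      by (rule root_connected_image[where r = "rroot H"])
        (use assms r closed[rule_format, of "1 # _"] in \<open>auto simp: cubic_rooted_def nbrs_closure_graph\<close>)
    show "pverts ?C \<subseteq> S"
      using 0 1 by (simp add: pverts_closure_graph)
  qed
  with assms pg show "Digraph_Component.connected (with_proj ?C)"
    by (intro connected_if_root_connected) (auto simp: pverts_closure_graph cubic_rooted_def)
  have "out_degree (with_proj ?C) v = card (nbrs ?C v)" for v
  proof -
    have "out_arcs (with_proj ?C) v = Pair v ` nbrs ?C v"
      by (auto simp: out_arcs_def nbrs_def)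
    then show ?thesis
      by (simp add: out_degree_def card_image inj_on_def)
  qed
  then show "cubic ?C"
    using assms finite_nbrs[of "rgraph H"] unfolding cubic_def cubic_rooted_def
    by (auto simp: pverts_closure_graph nbrs_closure_graph card_image card_insert_if image_iff)
qed

section \<open>Domination and packing by closed neighbourhoods\<close>

text \<open>
The set \<open>W\<close> of vertices that have to be dominated is a parameter, because the part of a dominating
set that lies in one piece of a graph may leave undominated those vertices of the piece that have
a neighbour outside.
\<close>

definition dominates_on :: "'a pair_pre_digraph \<Rightarrow> 'a set \<Rightarrow> 'a set \<Rightarrow> bool" where
  "dominates_on G W D \<longleftrightarrow> D \<subseteq> pverts G \<and> (\<forall>v \<in> W. D \<inter> closed_nbhd G v \<noteq> {})"

text \<open>
The dual condition to domination: every closed neighbourhood meets the set at most once instead of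
at least once. In contrast to distances it can be read off each piece of a graph and the edges that
leave the piece.
\<close>

definition nbhd_packing :: "'a pair_pre_digraph \<Rightarrow> 'a set \<Rightarrow> bool" where
  "nbhd_packing G P \<longleftrightarrow> P \<subseteq> pverts G
     \<and> (\<forall>v \<in> pverts G. \<forall>a \<in> P \<inter> closed_nbhd G v. \<forall>b \<in> P \<inter> closed_nbhd G v. a = b)"

text \<open>
With unit weights the cost of a walk is its length, so distance at least 3 only has to exclude the
walks with no arc, one arc and two arcs.
\<close>

lemma three_le_graph_dist_iff:
  assumes "pair_graph G" "u \<in> pverts G" "u \<noteq> v"
  shows "3 \<le> graph_dist G u v \<longleftrightarrow> v \<notin> nbrs G u \<and> (\<forall>w \<in> nbrs G u. v \<notin> nbrs G w)"
proof -
  interpret pair_graph G by (rule assms)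
  have cost: "awalk_cost (\<lambda>_. 1) p = real (length p)" for p
    by (induction p) auto
  have "3 \<le> graph_dist G u v \<longleftrightarrow> (\<forall>p. awalk u p v \<longrightarrow> 3 \<le> length p)"
    unfolding graph_dist_def \<mu>_def le_INF_iff cost by auto
  also have "\<dots> \<longleftrightarrow> v \<notin> nbrs G u \<and> (\<forall>w \<in> nbrs G u. v \<notin> nbrs G w)"
  proof (intro iffI conjI ballI notI allI impI)
    assume long: "\<forall>p. awalk u p v \<longrightarrow> 3 \<le> length p"
    { assume "v \<in> nbrs G u"
      then have "awalk u [(u, v)] v"
        by (auto simp: awalk_Cons_iff awalk_Nil_iff nbrs_def dest: in_arcsD2)
      then show False using long by force }
    { fix w assume "w \<in> nbrs G u" "v \<in> nbrs G w"
      then have "awalk u [(u, w), (w, v)] v"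
        by (auto simp: awalk_Cons_iff awalk_Nil_iff nbrs_def dest: in_arcsD2)
      then show False using long by force }
  next
    fix p
    assume far: "v \<notin> nbrs G u \<and> (\<forall>w \<in> nbrs G u. v \<notin> nbrs G w)" and p: "awalk u p v"
    show "3 \<le> length p"
    proof (rule ccontr)
      assume "\<not> 3 \<le> length p"
      then have "length p = 0 \<or> length p = Suc 0 \<or> length p = Suc (Suc 0)"
        by linarith
      then consider "p = []" | e where "p = [e]" | e f where "p = [e, f]"
        by (auto simp: length_Suc_conv)
      then show False
        using p far assms(3)
        by cases (auto simp: awalk_Cons_iff awalk_Nil_iff nbrs_def)
    qed
  qed
  finally show ?thesis .
qed

text \<open>
Two distinct vertices have distance at most 2 iff they lie in a common closed neighbourhood: that of
one of them if they are adjacent, and that of the middle vertex of a walk of length 2 otherwise.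
\<close>

lemma packing_iff_nbhd_packing:
  assumes "pair_graph G"
  shows "packing G P \<longleftrightarrow> nbhd_packing G P"
proof (cases "P \<subseteq> pverts G")
  case True
  have sym: "w \<in> nbrs G v \<longleftrightarrow> v \<in> nbrs G w" for v w
    using assms by (auto simp: pair_graph_iff)
  have "packing G P \<longleftrightarrow> (\<forall>a \<in> P. \<forall>b \<in> P. a \<noteq> b \<longrightarrow> b \<notin> nbrs G a \<and> (\<forall>w \<in> nbrs G a. b \<notin> nbrs G w))"
    using True three_le_graph_dist_iff[OF assms] by (auto simp: packing_def subset_iff)
  also have "\<dots> \<longleftrightarrow> nbhd_packing G P"
  proof (intro iffI ballI impI conjI notI)
    assume far: "\<forall>a \<in> P. \<forall>b \<in> P. a \<noteq> b \<longrightarrow> b \<notin> nbrs G a \<and> (\<forall>w \<in> nbrs G a. b \<notin> nbrs G w)"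
    show "nbhd_packing G P"
      unfolding nbhd_packing_def
    proof (intro conjI ballI)
      fix v a b
      assume "a \<in> P \<inter> closed_nbhd G v" "b \<in> P \<inter> closed_nbhd G v"
      then have "a = b \<or> b \<in> nbrs G a \<or> (v \<in> nbrs G a \<and> b \<in> nbrs G v)"
        using sym[of a v] by (auto simp: closed_nbhd_nbrs)
      then show "a = b"
        using far \<open>a \<in> P \<inter> _\<close> \<open>b \<in> P \<inter> _\<close> by blast
    qed (rule True)
  next
    fix a b
    assume t: "nbhd_packing G P" and ab: "a \<in> P" "b \<in> P" "a \<noteq> b"
    { assume "b \<in> nbrs G a"
      then show False
        using t[unfolded nbhd_packing_def, THEN conjunct2, rule_format, of a a b] ab True
        by (auto simp: closed_nbhd_nbrs) }
    { fix w
      assume "w \<in> nbrs G a" "b \<in> nbrs G w"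
      then show False
        using t[unfolded nbhd_packing_def, THEN conjunct2, rule_format, of w a b] ab nbrs_subset[OF assms, of a] sym[of w a]
        by (auto simp: closed_nbhd_nbrs) }
  qed
  finally show ?thesis .
qed (simp add: packing_def nbhd_packing_def)

lemma domination_number_eqI:
  assumes "finite (pverts G)" "dominates_on G (pverts G) D"
    and "\<And>D'. dominates_on G (pverts G) D' \<Longrightarrow> card D \<le> card D'"
  shows "domination_number G = card D"
proof -
  have eq: "dominating G = dominates_on G (pverts G)"
    by (auto simp: dominating_def dominates_on_def fun_eq_iff)
  have "finite {D. dominates_on G (pverts G) D}"
    by (rule finite_subset[of _ "Pow (pverts G)"]) (use assms(1) in \<open>auto simp: dominates_on_def\<close>)
  then show ?thesis
    unfolding domination_number_def eq by (intro Min_eqI) (use assms in auto)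
qed

lemma packing_number_eqI:
  assumes "pair_graph G" "nbhd_packing G P"
    and "\<And>P'. nbhd_packing G P' \<Longrightarrow> card P' \<le> card P"
  shows "packing_number G = card P"
proof -
  have eq: "packing G = nbhd_packing G"
    using packing_iff_nbhd_packing[OF assms(1)] by auto
  have "finite {P. nbhd_packing G P}"
    by (rule finite_subset[of _ "Pow (pverts G)"]) (use assms(1) in \<open>auto simp: nbhd_packing_def pair_graph_iff\<close>)
  then show ?thesis
    unfolding packing_number_def eq by (intro Max_eqI) (use assms in auto)
qed

text \<open>
Restriction of a dominating set to a piece \<open>f\<close> of the graph: the condition says that the vertices in
\<open>U\<close> owe their domination to the piece alone.
\<close>

lemma dominates_on_vimage:
  assumes "dominates_on G W D" "f -` D \<subseteq> pverts H"
    and "\<And>v. v \<in> U \<Longrightarrow> f v \<in> W \<and> D \<inter> closed_nbhd G (f v) \<subseteq> f ` closed_nbhd H v"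
  shows "dominates_on H U (f -` D)"
  using assms unfolding dominates_on_def by blast

lemma image_Int_not_empty: "A \<inter> B \<noteq> {} \<Longrightarrow> f ` A \<subseteq> A' \<Longrightarrow> f ` B \<subseteq> B' \<Longrightarrow> A' \<inter> B' \<noteq> {}"
  by blast

lemma nbhd_packing_vimage:
  assumes "nbhd_packing G P" "inj f" "f ` pverts H \<subseteq> pverts G" "f -` P \<subseteq> pverts H"
    and "\<And>v. f ` closed_nbhd H v \<subseteq> closed_nbhd G (f v)"
  shows "nbhd_packing H (f -` P)"
  unfolding nbhd_packing_def
proof (intro conjI ballI)
  fix v a b
  assume v: "v \<in> pverts H" and "a \<in> f -` P \<inter> closed_nbhd H v" "b \<in> f -` P \<inter> closed_nbhd H v"
  then have "f a \<in> P \<inter> closed_nbhd G (f v)" "f b \<in> P \<inter> closed_nbhd G (f v)" "f v \<in> pverts G"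
    using assms(3,5) by blast+
  then have "f a = f b"
    using assms(1) unfolding nbhd_packing_def by blast
  then show "a = b"
    using assms(2) by (simp add: inj_eq)
qed (rule assms(4))

text \<open>
Pairwise closeness outside \<open>Q\<close> means that a packing has at most one vertex outside \<open>Q\<close>. For a
concrete graph the hypothesis is a finite check.
\<close>

lemma card_packing_le_if_close:
  assumes P: "nbhd_packing G P" and fin: "finite (pverts G)"
    and close: "\<forall>a \<in> pverts G - Q. \<forall>b \<in> pverts G - Q.
      a = b \<or> (\<exists>v \<in> pverts G. a \<in> closed_nbhd G v \<and> b \<in> closed_nbhd G v)"
  shows "card P \<le> 1 + card (P \<inter> Q)"
proof -
  have sub: "P \<subseteq> pverts G"
    using P by (simp add: nbhd_packing_def)
  then have "finite P"
    using fin by (rule finite_subset)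
  have "a = b" if "a \<in> P - Q" "b \<in> P - Q" for a b
    using P close sub that unfolding nbhd_packing_def by blast
  then have "card (P - Q) \<le> 1"
    using \<open>finite P\<close> by (auto simp: card_le_Suc0_iff_eq One_nat_def)
  moreover have "card P = card (P \<inter> Q) + card (P - Q)"
    using \<open>finite P\<close> by (rule card_Int_Diff)
  ultimately show ?thesis by simp
qed

text \<open>
Reduces the lower bound 3 for a dominating set to a check over all pairs of vertices, where the two
members of a pair may coincide and so also cover the one-element sets.
\<close>

lemma three_le_card_dominating:
  assumes D: "dominates_on G W D" and fin: "finite (pverts G)" and "W \<noteq> {}"
    and pairs: "\<forall>a \<in> pverts G. \<forall>b \<in> pverts G. \<exists>v \<in> W. a \<notin> closed_nbhd G v \<and> b \<notin> closed_nbhd G v"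
  shows "3 \<le> card D"
proof (rule ccontr)
  assume "\<not> 3 \<le> card D"
  have sub: "D \<subseteq> pverts G"
    using D by (simp add: dominates_on_def)
  then have "finite D"
    using fin by (rule finite_subset)
  moreover have "D \<noteq> {}"
    using D \<open>W \<noteq> {}\<close> unfolding dominates_on_def by blast
  ultimately have "card D = 1 \<or> card D = 2"
    using \<open>\<not> 3 \<le> card D\<close> card_gt_0_iff[of D] by linarith
  then obtain a b where ab: "D = {a, b}"
    by (auto simp: card_1_singleton_iff card_2_iff One_nat_def)
  with sub pairs obtain v where "v \<in> W" "a \<notin> closed_nbhd G v" "b \<notin> closed_nbhd G v"
    by auto
  with D ab show False
    unfolding dominates_on_def by blast
qed

section \<open>Connector compositions\<close>

lemma connector_comp_split:
  assumes "X \<subseteq> pverts (rgraph (connector_comp K H1 H2))"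
    and "finite (pverts (rgraph K))" "finite (pverts (rgraph H1))" "finite (pverts (rgraph H2))"
  shows "(#) 0 -` X \<subseteq> pverts (rgraph K)" "(#) 1 -` X \<subseteq> pverts (rgraph H1)"
    "(#) 2 -` X \<subseteq> pverts (rgraph H2)"
    "card X = card ((#) 0 -` X) + card ((#) 1 -` X) + card ((#) 2 -` X)"
proof -
  show sub: "(#) 0 -` X \<subseteq> pverts (rgraph K)" "(#) 1 -` X \<subseteq> pverts (rgraph H1)"
    "(#) 2 -` X \<subseteq> pverts (rgraph H2)"
    using assms(1) by (auto simp: pverts_connector_comp)
  have fin: "finite ((#) 0 -` X)" "finite ((#) 1 -` X)" "finite ((#) 2 -` X)"
    using sub assms(2-4) by (blast intro: finite_subset)+
  have "X = (#) 0 ` ((#) 0 -` X) \<union> (#) 1 ` ((#) 1 -` X) \<union> (#) 2 ` ((#) 2 -` X)"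
    using assms(1) by (auto simp: pverts_connector_comp)
  then have "card X = card ((#) 0 ` ((#) 0 -` X) \<union> (#) 1 ` ((#) 1 -` X) \<union> (#) 2 ` ((#) 2 -` X))"
    by (rule arg_cong)
  also have "\<dots> = card ((#) 0 -` X) + card ((#) 1 -` X) + card ((#) 2 -` X)"
    by (rule card_Un_copies3[OF fin])
  finally show "card X = card ((#) 0 -` X) + card ((#) 1 -` X) + card ((#) 2 -` X)" .
qed

text \<open>
A vertex of a piece can be dominated from outside the piece only along one of the two new edges. A
child's root may therefore lose its dominator, and a port is certain to be dominated inside the
connector only if the root of its child is not chosen.
\<close>

lemma domination_off_root_connector_comp:
  assumes D: "dominates_on (rgraph (connector_comp K H1 H2))
      (pverts (rgraph (connector_comp K H1 H2)) - {rroot (connector_comp K H1 H2)}) D"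
    and fin: "finite (pverts (rgraph K))" "finite (pverts (rgraph H1))" "finite (pverts (rgraph H2))"
  obtains D0 D1 D2 where
    "dominates_on (rgraph K) (pverts (rgraph K) - {rroot K}
        - (if rroot H1 \<in> D1 then {port1 K} else {}) - (if rroot H2 \<in> D2 then {port2 K} else {})) D0"
    "dominates_on (rgraph H1) (pverts (rgraph H1) - {rroot H1}) D1"
    "dominates_on (rgraph H2) (pverts (rgraph H2) - {rroot H2}) D2"
    "card D = card D0 + card D1 + card D2"
proof
  have sub: "D \<subseteq> pverts (rgraph (connector_comp K H1 H2))"
    using D by (simp add: dominates_on_def)
  note s = connector_comp_split[OF sub fin]
  show "card D = card ((#) 0 -` D) + card ((#) 1 -` D) + card ((#) 2 -` D)"
    by (rule s)
  show "dominates_on (rgraph K) (pverts (rgraph K) - {rroot K}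
      - (if rroot H1 \<in> (#) 1 -` D then {port1 K} else {})
      - (if rroot H2 \<in> (#) 2 -` D then {port2 K} else {})) ((#) 0 -` D)"
    by (rule dominates_on_vimage[OF D s(1)])
      (auto simp: pverts_connector_comp rroot_connector_comp closed_nbhd_connector_comp split: if_splits)
  show "dominates_on (rgraph H1) (pverts (rgraph H1) - {rroot H1}) ((#) 1 -` D)"
    by (rule dominates_on_vimage[OF D s(2)])
      (auto simp: pverts_connector_comp rroot_connector_comp closed_nbhd_connector_comp)
  show "dominates_on (rgraph H2) (pverts (rgraph H2) - {rroot H2}) ((#) 2 -` D)"
    by (rule dominates_on_vimage[OF D s(3)])
      (auto simp: pverts_connector_comp rroot_connector_comp closed_nbhd_connector_comp)
qed

lemma domination_connector_comp:
  assumes "dominates_on (rgraph K) (pverts (rgraph K)) D0"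
    "dominates_on (rgraph H1) (pverts (rgraph H1)) D1" "dominates_on (rgraph H2) (pverts (rgraph H2)) D2"
  shows "dominates_on (rgraph (connector_comp K H1 H2)) (pverts (rgraph (connector_comp K H1 H2)))
    ((#) 0 ` D0 \<union> (#) 1 ` D1 \<union> (#) 2 ` D2)"
  unfolding dominates_on_def
proof (intro conjI ballI)
  fix v
  assume "v \<in> pverts (rgraph (connector_comp K H1 H2))"
  then consider w where "v = 0 # w" "D0 \<inter> closed_nbhd (rgraph K) w \<noteq> {}"
    | w where "v = 1 # w" "D1 \<inter> closed_nbhd (rgraph H1) w \<noteq> {}"
    | w where "v = 2 # w" "D2 \<inter> closed_nbhd (rgraph H2) w \<noteq> {}"
    using assms by (auto simp: dominates_on_def pverts_connector_comp)
  then show "((#) 0 ` D0 \<union> (#) 1 ` D1 \<union> (#) 2 ` D2)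
      \<inter> closed_nbhd (rgraph (connector_comp K H1 H2)) v \<noteq> {}"
    by cases (erule image_Int_not_empty[where f = "(#) (hd v)"]; auto simp: closed_nbhd_connector_comp)+
qed (use assms in \<open>auto simp: dominates_on_def pverts_connector_comp\<close>)

text \<open>
The coupling between connector and child that matters: the closed neighbourhood of a child's root
contains the port, so a chosen port forbids every chosen vertex in the neighbourhood that the root
has within the child.
\<close>

lemma packing_connector_compE:
  assumes P: "nbhd_packing (rgraph (connector_comp K H1 H2)) P"
    and fin: "finite (pverts (rgraph K))" "finite (pverts (rgraph H1))" "finite (pverts (rgraph H2))"
    and roots: "rroot H1 \<in> pverts (rgraph H1)" "rroot H2 \<in> pverts (rgraph H2)"
  obtains P0 P1 P2 where
    "nbhd_packing (rgraph K) P0" "nbhd_packing (rgraph H1) P1" "nbhd_packing (rgraph H2) P2"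
    "port1 K \<in> P0 \<Longrightarrow> P1 \<inter> closed_nbhd (rgraph H1) (rroot H1) = {}"
    "port2 K \<in> P0 \<Longrightarrow> P2 \<inter> closed_nbhd (rgraph H2) (rroot H2) = {}"
    "card P = card P0 + card P1 + card P2"
proof
  let ?C = "rgraph (connector_comp K H1 H2)"
  have sub: "P \<subseteq> pverts (rgraph (connector_comp K H1 H2))"
    using P by (simp add: nbhd_packing_def)
  note s = connector_comp_split[OF sub fin]
  show "card P = card ((#) 0 -` P) + card ((#) 1 -` P) + card ((#) 2 -` P)"
    by (rule s)
  show "nbhd_packing (rgraph K) ((#) 0 -` P)"
    by (rule nbhd_packing_vimage[OF P _ _ s(1)]) (auto simp: pverts_connector_comp closed_nbhd_connector_comp)
  show "nbhd_packing (rgraph H1) ((#) 1 -` P)"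
    by (rule nbhd_packing_vimage[OF P _ _ s(2)]) (auto simp: pverts_connector_comp closed_nbhd_connector_comp)
  show "nbhd_packing (rgraph H2) ((#) 2 -` P)"
    by (rule nbhd_packing_vimage[OF P _ _ s(3)]) (auto simp: pverts_connector_comp closed_nbhd_connector_comp)
  show "(#) 1 -` P \<inter> closed_nbhd (rgraph H1) (rroot H1) = {}" if "port1 K \<in> (#) 0 -` P"
  proof (intro equals0I)
    fix x
    assume "x \<in> (#) 1 -` P \<inter> closed_nbhd (rgraph H1) (rroot H1)"
    then have "1 # x \<in> P \<inter> closed_nbhd ?C (1 # rroot H1)"
      by (auto simp: closed_nbhd_connector_comp)
    moreover have "0 # port1 K \<in> P \<inter> closed_nbhd ?C (1 # rroot H1)"
      using that by (auto simp: closed_nbhd_connector_comp)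
    moreover have "1 # rroot H1 \<in> pverts ?C"
      using roots by (auto simp: pverts_connector_comp)
    ultimately have "1 # x = 0 # port1 K"
      using P unfolding nbhd_packing_def by blast
    then show False by simp
  qed
  show "(#) 2 -` P \<inter> closed_nbhd (rgraph H2) (rroot H2) = {}" if "port2 K \<in> (#) 0 -` P"
  proof (intro equals0I)
    fix x
    assume "x \<in> (#) 2 -` P \<inter> closed_nbhd (rgraph H2) (rroot H2)"
    then have "2 # x \<in> P \<inter> closed_nbhd ?C (2 # rroot H2)"
      by (auto simp: closed_nbhd_connector_comp)
    moreover have "0 # port2 K \<in> P \<inter> closed_nbhd ?C (2 # rroot H2)"
      using that by (auto simp: closed_nbhd_connector_comp)
    moreover have "2 # rroot H2 \<in> pverts ?C"
      using roots by (auto simp: pverts_connector_comp)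
    ultimately have "2 # x = 0 # port2 K"
      using P unfolding nbhd_packing_def by blast
    then show False by simp
  qed
qed

text \<open>
If no vertex of the connector that is close to a port is chosen, then the only vertex of the packing
that a port can see is the root of its child, and no child notices the connector at all.
\<close>

lemma packing_connector_comp:
  assumes "nbhd_packing (rgraph K) P0" "nbhd_packing (rgraph H1) P1" "nbhd_packing (rgraph H2) P2"
    and ports: "port1 K \<noteq> port2 K" "P0 \<inter> closed_nbhd (rgraph K) (port1 K) = {}"
      "P0 \<inter> closed_nbhd (rgraph K) (port2 K) = {}"
  shows "nbhd_packing (rgraph (connector_comp K H1 H2)) ((#) 0 ` P0 \<union> (#) 1 ` P1 \<union> (#) 2 ` P2)"
proof -
  let ?P = "(#) 0 ` P0 \<union> (#) 1 ` P1 \<union> (#) 2 ` P2"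
  let ?C = "rgraph (connector_comp K H1 H2)"
  have ports': "port1 K \<notin> P0" "port2 K \<notin> P0"
    using ports by (auto simp: closed_nbhd_nbrs)
  have nbhd: "?P \<inter> closed_nbhd ?C (1 # v) = (#) 1 ` (P1 \<inter> closed_nbhd (rgraph H1) v)"
    "?P \<inter> closed_nbhd ?C (2 # v) = (#) 2 ` (P2 \<inter> closed_nbhd (rgraph H2) v)" for v
    using ports' by (auto simp: closed_nbhd_connector_comp split: if_splits)
  have nbhd0: "?P \<inter> closed_nbhd ?C (0 # v) = (#) 0 ` (P0 \<inter> closed_nbhd (rgraph K) v)"
    if "v \<noteq> port1 K" "v \<noteq> port2 K" for v
    using that by (auto simp: closed_nbhd_connector_comp)
  have nbhd_port: "?P \<inter> closed_nbhd ?C (0 # port1 K) \<subseteq> {1 # rroot H1}"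
    "?P \<inter> closed_nbhd ?C (0 # port2 K) \<subseteq> {2 # rroot H2}"
    using ports by (auto simp: closed_nbhd_connector_comp)
  show ?thesis
    unfolding nbhd_packing_def
  proof (intro conjI ballI)
    show "?P \<subseteq> pverts ?C"
      using assms(1-3) by (auto simp: nbhd_packing_def pverts_connector_comp)
    fix v a b
    assume v: "v \<in> pverts ?C" and ab: "a \<in> ?P \<inter> closed_nbhd ?C v" "b \<in> ?P \<inter> closed_nbhd ?C v"
    consider (core) w where "v = 0 # w" "w \<in> pverts (rgraph K)" "w \<noteq> port1 K" "w \<noteq> port2 K"
      | (port1) "v = 0 # port1 K" | (port2) "v = 0 # port2 K"
      | (child1) w where "v = 1 # w" "w \<in> pverts (rgraph H1)"
      | (child2) w where "v = 2 # w" "w \<in> pverts (rgraph H2)"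
      using v by (auto simp: pverts_connector_comp)
    then show "a = b"
    proof cases
      case core
      with ab have "a \<in> (#) 0 ` (P0 \<inter> closed_nbhd (rgraph K) w)" "b \<in> (#) 0 ` (P0 \<inter> closed_nbhd (rgraph K) w)"
        by (simp_all only: nbhd0 not_False_eq_True)
      with assms(1) core show ?thesis unfolding nbhd_packing_def by blast
    next
      case child1
      with ab have "a \<in> (#) 1 ` (P1 \<inter> closed_nbhd (rgraph H1) w)" "b \<in> (#) 1 ` (P1 \<inter> closed_nbhd (rgraph H1) w)"
        by (simp_all only: nbhd not_False_eq_True)
      with assms(2) child1 show ?thesis unfolding nbhd_packing_def by blast
    next
      case child2
      with ab have "a \<in> (#) 2 ` (P2 \<inter> closed_nbhd (rgraph H2) w)" "b \<in> (#) 2 ` (P2 \<inter> closed_nbhd (rgraph H2) w)"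
        by (simp_all only: nbhd not_False_eq_True)
      with assms(3) child2 show ?thesis unfolding nbhd_packing_def by blast
    next
      case port1
      show ?thesis
        using subsetD[OF nbhd_port(1) ab(1)[unfolded port1]] subsetD[OF nbhd_port(1) ab(2)[unfolded port1]]
        by (simp only: singleton_iff)
    next
      case port2
      show ?thesis
        using subsetD[OF nbhd_port(2) ab(1)[unfolded port2]] subsetD[OF nbhd_port(2) ab(2)[unfolded port2]]
        by (simp only: singleton_iff)
    qed
  qed
qed

section \<open>The bowtie\<close>

lemma bowtie_split:
  assumes X: "X \<subseteq> pverts (rgraph (bowtie H))" and fin: "finite (pverts (rgraph H))"
  shows "card X = card ((\<lambda>v. 0 # 0 # v) -` X) + card ((\<lambda>v. 1 # 0 # v) -` X)
    + of_bool (rroot (bowtie H) \<in> X)"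
proof -
  let ?A = "(\<lambda>v. 0 # 0 # v) -` X" and ?B = "(\<lambda>v. 1 # 0 # v) -` X"
  have "?A \<subseteq> pverts (rgraph H)" "?B \<subseteq> pverts (rgraph H)"
    using X by (auto simp: pverts_bowtie)
  with fin have finAB: "finite ?A" "finite ?B"
    by (blast intro: finite_subset)+
  define Y where "Y = (\<lambda>v. (0::nat) # 0 # v) ` ?A \<union> (\<lambda>v. 1 # 0 # v) ` ?B"
  have "card Y = card ?A + card ?B"
    unfolding Y_def by (rule card_Un_image_disjoint) (use finAB in \<open>auto simp: inj_def\<close>)
  moreover have "finite Y" "[0] \<notin> Y"
    using finAB by (auto simp: Y_def simp del: image_vimage_eq)
  moreover have "X = (if [0] \<in> X then insert [0] Y else Y)"
    using X by (auto simp: Y_def pverts_bowtie)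
  then have "card X = card (if [0] \<in> X then insert [0] Y else Y)"
    by (rule arg_cong)
  ultimately show ?thesis
    by (simp add: rroot_bowtie)
qed

text \<open>
In each copy of \<open>H\<close> only the root can profit from the new root, and it is excused anyway. So both
copies pay in full and the new root comes on top.
\<close>

lemma domination_off_root_bowtie:
  assumes D: "dominates_on (rgraph (bowtie H)) (pverts (rgraph (bowtie H)) - {rroot (bowtie H)}) D"
    and fin: "finite (pverts (rgraph H))"
    and low: "\<And>D. dominates_on (rgraph H) (pverts (rgraph H) - {rroot H}) D \<Longrightarrow> k \<le> card D"
  shows "2 * k + of_bool (rroot (bowtie H) \<in> D) \<le> card D"
proof -
  have sub: "D \<subseteq> pverts (rgraph (bowtie H))"
    using D by (simp add: dominates_on_def)
  have sub0: "(\<lambda>v. 0 # 0 # v) -` D \<subseteq> pverts (rgraph H)"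
    and sub1: "(\<lambda>v. 1 # 0 # v) -` D \<subseteq> pverts (rgraph H)"
    using sub by (auto simp: pverts_bowtie)
  have "dominates_on (rgraph H) (pverts (rgraph H) - {rroot H}) ((\<lambda>v. 0 # 0 # v) -` D)"
    by (rule dominates_on_vimage[OF D sub0]) (auto simp: pverts_bowtie rroot_bowtie closed_nbhd_bowtie)
  moreover have "dominates_on (rgraph H) (pverts (rgraph H) - {rroot H}) ((\<lambda>v. 1 # 0 # v) -` D)"
    by (rule dominates_on_vimage[OF D sub1]) (auto simp: pverts_bowtie rroot_bowtie closed_nbhd_bowtie)
  ultimately show ?thesis
    using low[of "(\<lambda>v. 0 # 0 # v) -` D"] low[of "(\<lambda>v. 1 # 0 # v) -` D"] bowtie_split[OF sub fin]
    by simp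
qed

text \<open>
A chosen root in the copies takes care of the new root at no extra cost.
\<close>

lemma domination_bowtie:
  assumes "dominates_on (rgraph H) (pverts (rgraph H)) D" "rroot H \<in> D"
  shows "dominates_on (rgraph (bowtie H)) (pverts (rgraph (bowtie H)))
    ((\<lambda>v. 0 # 0 # v) ` D \<union> (\<lambda>v. 1 # 0 # v) ` D)"
  unfolding dominates_on_def
proof (intro conjI ballI)
  let ?J = "rgraph (bowtie H)"
  let ?D = "(\<lambda>v. 0 # 0 # v) ` D \<union> (\<lambda>v. 1 # 0 # v) ` D"
  fix v
  assume "v \<in> pverts ?J"
  then consider "v = [0]"
    | w where "v = 0 # 0 # w" "D \<inter> closed_nbhd (rgraph H) w \<noteq> {}"
    | w where "v = 1 # 0 # w" "D \<inter> closed_nbhd (rgraph H) w \<noteq> {}"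
    using assms(1) by (auto simp: dominates_on_def pverts_bowtie)
  then show "?D \<inter> closed_nbhd ?J v \<noteq> {}"
  proof cases
    case 1
    then show ?thesis using assms(2) by (auto simp: closed_nbhd_bowtie)
  next
    case 2
    show ?thesis
      by (rule image_Int_not_empty[OF 2(2), where f = "\<lambda>v. 0 # 0 # v"]) (auto simp: 2(1) closed_nbhd_bowtie)
  next
    case 3
    show ?thesis
      by (rule image_Int_not_empty[OF 3(2), where f = "\<lambda>v. 1 # 0 # v"]) (auto simp: 3(1) closed_nbhd_bowtie)
  qed
qed (use assms in \<open>auto simp: dominates_on_def pverts_bowtie\<close>)

text \<open>
The closed neighbourhood of the new root consists of this root and the roots of the two copies.
At most one of these three vertices is in the packing, so at most one surplus can be collected, and
only if the new root sees a vertex of the packing.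
\<close>

lemma packing_bowtie_le:
  assumes P: "nbhd_packing (rgraph (bowtie H)) P"
    and H: "finite (pverts (rgraph H))" "rroot H \<in> pverts (rgraph H)"
    and up: "\<And>P. nbhd_packing (rgraph H) P \<Longrightarrow> card P \<le> m + of_bool (rroot H \<in> P)"
  shows "card P \<le> 2 * m + of_bool (P \<inter> closed_nbhd (rgraph (bowtie H)) (rroot (bowtie H)) \<noteq> {})"
proof -
  let ?J = "rgraph (bowtie H)"
  have sub: "P \<subseteq> pverts ?J"
    using P by (simp add: nbhd_packing_def)
  have sub0: "(\<lambda>v. 0 # 0 # v) -` P \<subseteq> pverts (rgraph H)"
    and sub1: "(\<lambda>v. 1 # 0 # v) -` P \<subseteq> pverts (rgraph H)"
    using sub by (auto simp: pverts_bowtie)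
  have "nbhd_packing (rgraph H) ((\<lambda>v. 0 # 0 # v) -` P)"
    by (rule nbhd_packing_vimage[OF P _ _ sub0]) (auto simp: inj_def pverts_bowtie closed_nbhd_bowtie)
  moreover have "nbhd_packing (rgraph H) ((\<lambda>v. 1 # 0 # v) -` P)"
    by (rule nbhd_packing_vimage[OF P _ _ sub1]) (auto simp: inj_def pverts_bowtie closed_nbhd_bowtie)
  moreover have "of_bool (0 # 0 # rroot H \<in> P) + of_bool (1 # 0 # rroot H \<in> P) + of_bool ([0] \<in> P)
      = (of_bool (P \<inter> closed_nbhd ?J [0] \<noteq> {}) :: nat)"
  proof -
    have eq: "a = b" if "a \<in> P" "b \<in> P" "a \<in> closed_nbhd ?J [0]" "b \<in> closed_nbhd ?J [0]" for a b
      using P that unfolding nbhd_packing_def by (auto simp: pverts_bowtie)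
    have "[0] \<in> closed_nbhd ?J [0]" "0 # 0 # rroot H \<in> closed_nbhd ?J [0]" "1 # 0 # rroot H \<in> closed_nbhd ?J [0]"
      by (simp_all add: closed_nbhd_bowtie)
    then have "\<not> (0 # 0 # rroot H \<in> P \<and> 1 # 0 # rroot H \<in> P)" "\<not> (0 # 0 # rroot H \<in> P \<and> [0] \<in> P)"
      "\<not> (1 # 0 # rroot H \<in> P \<and> [0] \<in> P)"
      using eq[of "0 # 0 # rroot H" "1 # 0 # rroot H"] eq[of "0 # 0 # rroot H" "[0]"]
        eq[of "1 # 0 # rroot H" "[0]"] by auto
    then show ?thesis
      by (auto simp: closed_nbhd_bowtie)
  qed
  ultimately show ?thesis
    using up[of "(\<lambda>v. 0 # 0 # v) -` P"] up[of "(\<lambda>v. 1 # 0 # v) -` P"] bowtie_split[OF sub H(1)]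
    by (simp add: rroot_bowtie)
qed

text \<open>
The new root sees at most the root of the first copy.
\<close>

lemma packing_bowtie:
  assumes "nbhd_packing (rgraph H) P1" "nbhd_packing (rgraph H) P2" "rroot H \<notin> P2"
  shows "nbhd_packing (rgraph (bowtie H)) ((\<lambda>v. 0 # 0 # v) ` P1 \<union> (\<lambda>v. 1 # 0 # v) ` P2)"
proof -
  let ?P = "(\<lambda>v. 0 # 0 # v) ` P1 \<union> (\<lambda>v. 1 # 0 # v) ` P2"
  let ?J = "rgraph (bowtie H)"
  have nbhd: "?P \<inter> closed_nbhd ?J [0] \<subseteq> {0 # 0 # rroot H}"
    "?P \<inter> closed_nbhd ?J (0 # 0 # w) = (\<lambda>v. 0 # 0 # v) ` (P1 \<inter> closed_nbhd (rgraph H) w)"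
    "?P \<inter> closed_nbhd ?J (1 # 0 # w) = (\<lambda>v. 1 # 0 # v) ` (P2 \<inter> closed_nbhd (rgraph H) w)" for w
    using assms(3) by (auto simp: closed_nbhd_bowtie split: if_splits)
  show ?thesis
    unfolding nbhd_packing_def
  proof (intro conjI ballI)
    show "?P \<subseteq> pverts ?J"
      using assms(1,2) by (auto simp: nbhd_packing_def pverts_bowtie)
    fix v a b
    assume v: "v \<in> pverts ?J" and ab: "a \<in> ?P \<inter> closed_nbhd ?J v" "b \<in> ?P \<inter> closed_nbhd ?J v"
    consider "v = [0]" | w where "v = 0 # 0 # w" "w \<in> pverts (rgraph H)"
      | w where "v = 1 # 0 # w" "w \<in> pverts (rgraph H)"
      using v by (auto simp: pverts_bowtie)
    then show "a = b"
    proof cases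
      case 1
      show ?thesis
        using subsetD[OF nbhd(1) ab(1)[unfolded 1]] subsetD[OF nbhd(1) ab(2)[unfolded 1]]
        by (simp only: singleton_iff)
    next
      case 2
      with ab have "a \<in> (\<lambda>v. 0 # 0 # v) ` (P1 \<inter> closed_nbhd (rgraph H) w)"
        "b \<in> (\<lambda>v. 0 # 0 # v) ` (P1 \<inter> closed_nbhd (rgraph H) w)"
        by (simp_all only: nbhd)
      with assms(1) 2 show ?thesis unfolding nbhd_packing_def by blast
    next
      case 3
      with ab have "a \<in> (\<lambda>v. 1 # 0 # v) ` (P2 \<inter> closed_nbhd (rgraph H) w)"
        "b \<in> (\<lambda>v. 1 # 0 # v) ` (P2 \<inter> closed_nbhd (rgraph H) w)"
        by (simp_all only: nbhd)
      with assms(2) 3 show ?thesis unfolding nbhd_packing_def by blast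
    qed
  qed
qed

section \<open>Rigidity and the closure\<close>

text \<open>
Rigidity: being excused from dominating the root saves nothing.
\<close>

definition rigid_domination :: "nat list rooted \<Rightarrow> nat \<Rightarrow> bool" where
  "rigid_domination H k \<longleftrightarrow>
     (\<forall>D. dominates_on (rgraph H) (pverts (rgraph H) - {rroot H}) D \<longrightarrow> k \<le> card D)
     \<and> (\<exists>D. dominates_on (rgraph H) (pverts (rgraph H)) D \<and> card D = k)"

text \<open>
The dual form of rigidity: being forbidden to use the root costs nothing.
\<close>

definition rigid_packing :: "nat list rooted \<Rightarrow> nat \<Rightarrow> bool" where
  "rigid_packing H m \<longleftrightarrow>
     (\<forall>P. nbhd_packing (rgraph H) P \<longrightarrow> card P \<le> m)
     \<and> (\<exists>P. nbhd_packing (rgraph H) P \<and> rroot H \<notin> P \<and> card P = m)"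

lemma rigid_dominationI:
  assumes "\<And>D. dominates_on (rgraph H) (pverts (rgraph H) - {rroot H}) D \<Longrightarrow> k \<le> card D"
    and "dominates_on (rgraph H) (pverts (rgraph H)) D" "card D = k"
  shows "rigid_domination H k"
  unfolding rigid_domination_def using assms by blast

lemma rigid_packingI:
  assumes "\<And>P. nbhd_packing (rgraph H) P \<Longrightarrow> card P \<le> m"
    and "nbhd_packing (rgraph H) P" "rroot H \<notin> P" "card P = m"
  shows "rigid_packing H m"
  unfolding rigid_packing_def using assms by blast

lemma closure_graph_split:
  assumes "X \<subseteq> pverts (closure_graph H)" and "finite (pverts (rgraph H))"
  shows "(#) 0 -` X \<subseteq> pverts (rgraph H)" "(#) 1 -` X \<subseteq> pverts (rgraph H)"
    "card X = card ((#) 0 -` X) + card ((#) 1 -` X)"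
proof -
  show sub: "(#) 0 -` X \<subseteq> pverts (rgraph H)" "(#) 1 -` X \<subseteq> pverts (rgraph H)"
    using assms(1) by (auto simp: pverts_closure_graph)
  have fin: "finite ((#) 0 -` X)" "finite ((#) 1 -` X)"
    using sub assms(2) by (blast intro: finite_subset)+
  have "X = (#) 0 ` ((#) 0 -` X) \<union> (#) 1 ` ((#) 1 -` X)"
    using assms(1) by (auto simp: pverts_closure_graph)
  then have "card X = card ((#) 0 ` ((#) 0 -` X) \<union> (#) 1 ` ((#) 1 -` X))"
    by (rule arg_cong)
  also have "\<dots> = card ((#) 0 -` X) + card ((#) 1 -` X)"
    by (rule card_Un_copies[OF fin])
  finally show "card X = card ((#) 0 -` X) + card ((#) 1 -` X)" .
qed

text \<open>
The new edge can help only to dominate the two roots, which saves nothing by rigidity.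
\<close>

lemma domination_number_closure_graph:
  assumes fin: "finite (pverts (rgraph H))" and "rigid_domination H k"
  shows "domination_number (closure_graph H) = 2 * k"
proof -
  let ?C = "closure_graph H"
  obtain D where D: "dominates_on (rgraph H) (pverts (rgraph H)) D" "card D = k"
    and low: "\<And>D. dominates_on (rgraph H) (pverts (rgraph H) - {rroot H}) D \<Longrightarrow> k \<le> card D"
    using assms(2) by (auto simp: rigid_domination_def)
  define E where "E = (#) (0::nat) ` D \<union> (#) 1 ` D"
  have "finite D"
    using D(1) fin by (auto simp: dominates_on_def intro: finite_subset)
  then have card: "card E = 2 * k"
    unfolding E_def by (simp add: card_Un_copies D(2))
  have "dominates_on ?C (pverts ?C) E"
    unfolding dominates_on_def
  proof (intro conjI ballI)
    show "E \<subseteq> pverts ?C"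
      using D(1) by (auto simp: E_def dominates_on_def pverts_closure_graph)
    fix v
    assume "v \<in> pverts ?C"
    then consider w where "v = 0 # w" "D \<inter> closed_nbhd (rgraph H) w \<noteq> {}"
      | w where "v = 1 # w" "D \<inter> closed_nbhd (rgraph H) w \<noteq> {}"
      using D(1) by (auto simp: dominates_on_def pverts_closure_graph)
    then show "E \<inter> closed_nbhd ?C v \<noteq> {}"
      by cases (erule image_Int_not_empty[where f = "(#) (hd v)"];
          auto simp: E_def closed_nbhd_closure_graph)+
  qed
  moreover have "card E \<le> card D'" if D': "dominates_on ?C (pverts ?C) D'" for D'
  proof -
    have "D' \<subseteq> pverts ?C"
      using D' by (simp add: dominates_on_def)
    note s = closure_graph_split[OF this fin]
    have "dominates_on (rgraph H) (pverts (rgraph H) - {rroot H}) ((#) 0 -` D')"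
      by (rule dominates_on_vimage[OF D' s(1)]) (auto simp: pverts_closure_graph closed_nbhd_closure_graph)
    moreover have "dominates_on (rgraph H) (pverts (rgraph H) - {rroot H}) ((#) 1 -` D')"
      by (rule dominates_on_vimage[OF D' s(2)]) (auto simp: pverts_closure_graph closed_nbhd_closure_graph)
    ultimately show ?thesis
      using low[of "(#) 0 -` D'"] low[of "(#) 1 -` D'"] s(3) card by simp
  qed
  ultimately show ?thesis
    using domination_number_eqI[of ?C E] fin card by (simp add: pverts_closure_graph)
qed

text \<open>
Each copy contains at most \<open>m\<close> vertices of a packing, and two maximum packings that avoid the roots
do not interact across the new edge.
\<close>

lemma packing_number_closure_graph:
  assumes H: "cubic_rooted H" and "rigid_packing H m"
  shows "packing_number (closure_graph H) = 2 * m"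
proof -
  let ?C = "closure_graph H"
  have fin: "finite (pverts (rgraph H))"
    using H by (simp add: cubic_rooted_def pair_graph_iff)
  obtain P where P: "nbhd_packing (rgraph H) P" "rroot H \<notin> P" "card P = m"
    and up: "\<And>P. nbhd_packing (rgraph H) P \<Longrightarrow> card P \<le> m"
    using assms(2) by (auto simp: rigid_packing_def)
  define Q where "Q = (#) (0::nat) ` P \<union> (#) 1 ` P"
  have "finite P"
    using P(1) fin by (auto simp: nbhd_packing_def intro: finite_subset)
  then have card: "card Q = 2 * m"
    unfolding Q_def by (simp add: card_Un_copies P(3))
  have nbhd: "Q \<inter> closed_nbhd ?C (0 # w) = (#) 0 ` (P \<inter> closed_nbhd (rgraph H) w)"
    "Q \<inter> closed_nbhd ?C (1 # w) = (#) 1 ` (P \<inter> closed_nbhd (rgraph H) w)" for w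
    using P(2) by (auto simp: Q_def closed_nbhd_closure_graph split: if_splits)
  have "nbhd_packing ?C Q"
    unfolding nbhd_packing_def
  proof (intro conjI ballI)
    show "Q \<subseteq> pverts ?C"
      using P(1) by (auto simp: Q_def nbhd_packing_def pverts_closure_graph)
    fix v a b
    assume v: "v \<in> pverts ?C" and ab: "a \<in> Q \<inter> closed_nbhd ?C v" "b \<in> Q \<inter> closed_nbhd ?C v"
    consider w where "v = 0 # w" "w \<in> pverts (rgraph H)" | w where "v = 1 # w" "w \<in> pverts (rgraph H)"
      using v by (auto simp: pverts_closure_graph)
    then show "a = b"
    proof cases
      case 1
      with ab have "a \<in> (#) 0 ` (P \<inter> closed_nbhd (rgraph H) w)" "b \<in> (#) 0 ` (P \<inter> closed_nbhd (rgraph H) w)"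
        by (simp_all only: nbhd)
      with P(1) 1 show ?thesis unfolding nbhd_packing_def by blast
    next
      case 2
      with ab have "a \<in> (#) 1 ` (P \<inter> closed_nbhd (rgraph H) w)" "b \<in> (#) 1 ` (P \<inter> closed_nbhd (rgraph H) w)"
        by (simp_all only: nbhd)
      with P(1) 2 show ?thesis unfolding nbhd_packing_def by blast
    qed
  qed
  moreover have "card P' \<le> card Q" if P': "nbhd_packing ?C P'" for P'
  proof -
    have "P' \<subseteq> pverts ?C"
      using P' by (simp add: nbhd_packing_def)
    note s = closure_graph_split[OF this fin]
    have "nbhd_packing (rgraph H) ((#) 0 -` P')"
      by (rule nbhd_packing_vimage[OF P' _ _ s(1)]) (auto simp: pverts_closure_graph closed_nbhd_closure_graph)
    moreover have "nbhd_packing (rgraph H) ((#) 1 -` P')"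
      by (rule nbhd_packing_vimage[OF P' _ _ s(2)]) (auto simp: pverts_closure_graph closed_nbhd_closure_graph)
    ultimately show ?thesis
      using up[of "(#) 0 -` P'"] up[of "(#) 1 -` P'"] s(3) card by simp
  qed
  ultimately show ?thesis
    using packing_number_eqI[OF closure_graph_cubic(1)[OF H]] card by simp
qed

section \<open>The seed and the two connectors\<close>

lemma nbrs_letters: "nbrs (letters G) [i] = (\<lambda>i. [i]) ` nbrs G i"
  by (rule nbrs_relabel) (simp add: inj_def)

lemma pair_graph_letters: "pair_graph G \<Longrightarrow> pair_graph (letters G)"
  by (rule pair_graph_relabel) (simp_all add: inj_def)

lemma nbrs_graph_B:
  "nbrs graph_B 1 = {2, 9}" "nbrs graph_B 2 = {1, 3, 6}" "nbrs graph_B 3 = {2, 4, 8}"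
  "nbrs graph_B 4 = {3, 5, 7}" "nbrs graph_B 5 = {4, 6, 9}" "nbrs graph_B 6 = {2, 5, 7}"
  "nbrs graph_B 7 = {4, 6, 8}" "nbrs graph_B 8 = {3, 7, 9}" "nbrs graph_B 9 = {1, 5, 8}"
  unfolding nbrs_def graph_B_def symcl_def by auto

lemma pverts_graph_B: "pverts graph_B = {1, 2, 3, 4, 5, 6, 7, 8, 9}"
  by (auto simp: graph_B_def)

lemma pair_graph_graph_B: "pair_graph graph_B"
  by (auto simp: pair_graph_iff graph_B_def nbrs_def symcl_def)

definition graph_R :: "nat pair_pre_digraph" where
  "graph_R = add_edge 2 7 (subdivide graph_A (3, 4) 7)"

lemma nbrs_graph_R:
  "nbrs graph_R 1 = {2, 5}" "nbrs graph_R 2 = {1, 3, 7}" "nbrs graph_R 3 = {2, 6, 7}"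
  "nbrs graph_R 4 = {5, 7}" "nbrs graph_R 5 = {1, 4, 6}" "nbrs graph_R 6 = {3, 5}"
  "nbrs graph_R 7 = {2, 3, 4}"
  unfolding graph_R_def nbrs_add_edge unfolding nbrs_def graph_A_def symcl_def by auto

lemma pverts_graph_R: "pverts graph_R = {1, 2, 3, 4, 5, 6, 7}"
  by (auto simp: graph_R_def graph_A_def)

lemma pair_graph_graph_R: "pair_graph graph_R"
proof -
  have "pair_graph graph_A"
    by (auto simp: pair_graph_iff graph_A_def nbrs_def symcl_def)
  then have "pair_graph (subdivide graph_A (3, 4) 7)"
    by (rule pair_graph.pair_graph_subdivide) (auto simp: graph_A_def symcl_def)
  then show ?thesis
    unfolding graph_R_def by (rule pair_graph_add_edge) (auto simp: graph_A_def)
qed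

lemma nbrs_seed_B:
  "nbrs (rgraph seed_B) [1] = {[2], [9]}" "nbrs (rgraph seed_B) [2] = {[1], [3], [6]}"
  "nbrs (rgraph seed_B) [3] = {[2], [4], [8]}" "nbrs (rgraph seed_B) [4] = {[3], [5], [7]}"
  "nbrs (rgraph seed_B) [5] = {[4], [6], [9]}" "nbrs (rgraph seed_B) [6] = {[2], [5], [7]}"
  "nbrs (rgraph seed_B) [7] = {[4], [6], [8]}" "nbrs (rgraph seed_B) [8] = {[3], [7], [9]}"
  "nbrs (rgraph seed_B) [9] = {[1], [5], [8]}"
  by (simp_all add: seed_B_def nbrs_letters nbrs_graph_B)

lemma nbrs_connector_S:
  "nbrs (rgraph connector_S) [1] = {[2], [9]}" "nbrs (rgraph connector_S) [2] = {[1], [3], [6]}"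
  "nbrs (rgraph connector_S) [3] = {[2], [4], [8]}" "nbrs (rgraph connector_S) [4] = {[3], [5]}"
  "nbrs (rgraph connector_S) [5] = {[4], [6], [9]}" "nbrs (rgraph connector_S) [6] = {[2], [5], [7]}"
  "nbrs (rgraph connector_S) [7] = {[6], [8]}" "nbrs (rgraph connector_S) [8] = {[3], [7], [9]}"
  "nbrs (rgraph connector_S) [9] = {[1], [5], [8]}"
  by (simp_all add: connector_S_def nbrs_letters nbrs_del_edge nbrs_graph_B insert_Diff_if)

lemma nbrs_connector_R:
  "nbrs (rgraph connector_R) [1] = {[2], [5]}" "nbrs (rgraph connector_R) [2] = {[1], [3], [7]}"
  "nbrs (rgraph connector_R) [3] = {[2], [6], [7]}" "nbrs (rgraph connector_R) [4] = {[5], [7]}"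
  "nbrs (rgraph connector_R) [5] = {[1], [4], [6]}" "nbrs (rgraph connector_R) [6] = {[3], [5]}"
  "nbrs (rgraph connector_R) [7] = {[2], [3], [4]}"
  by (simp_all add: connector_R_def nbrs_letters nbrs_graph_R flip: graph_R_def)

lemma pverts_seed_B: "pverts (rgraph seed_B) = {[1], [2], [3], [4], [5], [6], [7], [8], [9]}"
  by (simp add: seed_B_def pverts_graph_B)

lemma pverts_connector_S: "pverts (rgraph connector_S) = {[1], [2], [3], [4], [5], [6], [7], [8], [9]}"
  by (simp add: connector_S_def pverts_graph_B pverts_del_edge)

lemma pverts_connector_R: "pverts (rgraph connector_R) = {[1], [2], [3], [4], [5], [6], [7]}"
  by (simp add: connector_R_def pverts_graph_R flip: graph_R_def)

lemma root_and_port_simps: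
  "rroot seed_B = [1]" "rroot connector_S = [1]" "port1 connector_S = [4]" "port2 connector_S = [7]"
  "rroot connector_R = [1]" "port1 connector_R = [4]" "port2 connector_R = [6]"
  by (simp_all add: seed_B_def connector_S_def connector_R_def)

lemma root_connected_connector_S: "root_connected (rgraph connector_S) [1]"
  unfolding root_connected_def
proof (intro allI impI)
  fix S
  assume S: "[1] \<in> S" "\<forall>v \<in> S. nbrs (rgraph connector_S) v \<subseteq> S"
  note c = S(2)[rule_format]
  have "[2] \<in> S" "[9] \<in> S" using c[of "[1]"] S(1) by (simp_all add: nbrs_connector_S)
  moreover from this have "[3] \<in> S" "[6] \<in> S" "[5] \<in> S" "[8] \<in> S"
    using c[of "[2]"] c[of "[9]"] by (simp_all add: nbrs_connector_S)
  moreover from this have "[4] \<in> S" "[7] \<in> S"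
    using c[of "[3]"] c[of "[6]"] by (simp_all add: nbrs_connector_S)
  ultimately show "pverts (rgraph connector_S) \<subseteq> S" using S(1) by (simp add: pverts_connector_S)
qed

lemma root_connected_seed_B: "root_connected (rgraph seed_B) [1]"
proof (rule root_connected_mono[OF root_connected_connector_S])
  show "nbrs (rgraph connector_S) v \<subseteq> nbrs (rgraph seed_B) v" for v
    by (auto simp: connector_S_def seed_B_def nbrs_relabel_iff nbrs_del_edge)
qed (simp add: pverts_seed_B pverts_connector_S)

lemma root_connected_connector_R: "root_connected (rgraph connector_R) [1]"
  unfolding root_connected_def
proof (intro allI impI)
  fix S
  assume S: "[1] \<in> S" "\<forall>v \<in> S. nbrs (rgraph connector_R) v \<subseteq> S"
  note c = S(2)[rule_format]
  have "[2] \<in> S" "[5] \<in> S" using c[of "[1]"] S(1) by (simp_all add: nbrs_connector_R)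
  moreover from this have "[3] \<in> S" "[7] \<in> S" "[4] \<in> S" "[6] \<in> S"
    using c[of "[2]"] c[of "[5]"] by (simp_all add: nbrs_connector_R)
  ultimately show "pverts (rgraph connector_R) \<subseteq> S" using S(1) by (simp add: pverts_connector_R)
qed

lemma cubic_rooted_seed_B: "cubic_rooted seed_B"
  unfolding cubic_rooted_def
proof (intro conjI)
  show "pair_graph (rgraph seed_B)"
    by (simp add: seed_B_def pair_graph_letters pair_graph_graph_B)
qed (simp_all add: root_and_port_simps root_connected_seed_B pverts_seed_B nbrs_seed_B)

lemma cubic_connector_S: "cubic_connector connector_S"
  unfolding cubic_connector_def
proof (intro conjI)
  show "pair_graph (rgraph connector_S)"
    by (simp add: connector_S_def pair_graph_letters pair_graph_del_edge pair_graph_graph_B)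
qed (simp_all add: root_and_port_simps root_connected_connector_S pverts_connector_S nbrs_connector_S)

lemma cubic_connector_R: "cubic_connector connector_R"
  unfolding cubic_connector_def
proof (intro conjI)
  show "pair_graph (rgraph connector_R)"
    by (simp add: connector_R_def pair_graph_letters pair_graph_graph_R flip: graph_R_def)
qed (simp_all add: root_and_port_simps root_connected_connector_R pverts_connector_R nbrs_connector_R)

text \<open>
Closed neighbourhoods in \<open>B\<close> have at most four vertices, so two of them would have to partition the
eight vertices other than the root, and no two do.
\<close>

lemma domination_off_root_seed_B:
  assumes "dominates_on (rgraph seed_B) (pverts (rgraph seed_B) - {rroot seed_B}) D"
  shows "3 \<le> card D"
  using assms
  by (rule three_le_card_dominating)
    (simp_all add: root_and_port_simps pverts_seed_B closed_nbhd_nbrs nbrs_seed_B insert_Diff_if)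

lemma packing_seed_B:
  assumes "nbhd_packing (rgraph seed_B) P"
  shows "card P \<le> 1 + of_bool (rroot seed_B \<in> P)"
proof -
  have "card P \<le> 1 + card (P \<inter> {[1]})"
    by (rule card_packing_le_if_close[OF assms])
      (simp_all add: pverts_seed_B closed_nbhd_nbrs nbrs_seed_B insert_Diff_if)
  then show ?thesis
    by (auto simp: root_and_port_simps split: if_splits)
qed

text \<open>
Adding the port \<open>b\<^sub>4\<close> if \<open>p\<close> holds and the port \<open>b\<^sub>7\<close> if \<open>q\<close> holds turns \<open>D\<close> into a set that
dominates the seed off its root, since the seed has the edges of \<open>S\<close> and one more. So the bound for
\<open>S\<close> is that for the seed.
\<close>

lemma domination_off_root_connector_S:
  assumes D: "dominates_on (rgraph connector_S) (pverts (rgraph connector_S) - {rroot connector_S}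
      - (if p then {port1 connector_S} else {}) - (if q then {port2 connector_S} else {})) D"
  shows "3 \<le> card D + of_bool p + of_bool q"
proof -
  let ?Q = "(if p then {[4]} else {}) \<union> (if q then {[7 :: nat]} else {})"
  have nbhd: "closed_nbhd (rgraph connector_S) v \<subseteq> closed_nbhd (rgraph seed_B) v"
    if "v \<in> pverts (rgraph seed_B)" for v
    using that by (auto simp: closed_nbhd_nbrs pverts_seed_B nbrs_seed_B nbrs_connector_S)
  have "dominates_on (rgraph seed_B) (pverts (rgraph seed_B) - {rroot seed_B}) (D \<union> ?Q)"
    unfolding dominates_on_def
  proof (intro conjI ballI)
    show "D \<union> ?Q \<subseteq> pverts (rgraph seed_B)"
      using D by (auto simp: dominates_on_def pverts_seed_B pverts_connector_S)
    fix v
    assume v: "v \<in> pverts (rgraph seed_B) - {rroot seed_B}"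
    show "(D \<union> ?Q) \<inter> closed_nbhd (rgraph seed_B) v \<noteq> {}"
    proof (cases "v \<in> ?Q")
      case True
      then show ?thesis by (auto simp: closed_nbhd_nbrs)
    next
      case False
      with v have "v \<in> pverts (rgraph connector_S) - {rroot connector_S}
          - (if p then {port1 connector_S} else {}) - (if q then {port2 connector_S} else {})"
        by (auto simp: root_and_port_simps pverts_seed_B pverts_connector_S)
      with D have "D \<inter> closed_nbhd (rgraph connector_S) v \<noteq> {}"
        unfolding dominates_on_def by blast
      with nbhd[of v] v show ?thesis by blast
    qed
  qed
  then have "3 \<le> card (D \<union> ?Q)"
    by (rule domination_off_root_seed_B)
  also have "\<dots> \<le> card D + card ?Q"
    by (rule card_Un_le)
  also have "card ?Q \<le> of_bool p + of_bool q"
    by auto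
  finally show ?thesis by simp
qed

text \<open>
In the seed, \<open>b\<^sub>4\<close> and \<open>b\<^sub>7\<close> are the two vertices that are not close to the root. Without the edge
between them the three form a packing; any two vertices other than the ports remain close.
\<close>

lemma packing_connector_S:
  assumes "nbhd_packing (rgraph connector_S) P"
  shows "card P \<le> 1 + of_bool (port1 connector_S \<in> P) + of_bool (port2 connector_S \<in> P)"
proof -
  have "card P \<le> 1 + card (P \<inter> {[4], [7]})"
    by (rule card_packing_le_if_close[OF assms])
      (simp_all add: pverts_connector_S closed_nbhd_nbrs nbrs_connector_S insert_Diff_if)
  also have "card (P \<inter> {[4], [7]}) = of_bool ([4] \<in> P) + of_bool ([7] \<in> P)"
    by (auto simp: Int_insert_right)
  finally show ?thesis
    by (simp add: root_and_port_simps)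
qed

text \<open>
A single vertex would have to lie in the closed neighbourhoods of \<open>a\<^sub>2\<close>, \<open>a\<^sub>3\<close> and \<open>a\<^sub>5\<close>, but
\<open>a\<^sub>1\<close> is the only common vertex of the first and the last of them, and \<open>a\<^sub>1a\<^sub>3\<close> is not an edge.
\<close>

lemma domination_off_root_connector_R:
  assumes D: "dominates_on (rgraph connector_R)
    (pverts (rgraph connector_R) - {rroot connector_R} - {port1 connector_R} - {port2 connector_R}) D"
  shows "2 \<le> card D"
proof (rule ccontr)
  assume "\<not> 2 \<le> card D"
  have D2: "D \<inter> {[1], [2], [3], [7]} \<noteq> {}" and D3: "D \<inter> {[2], [3], [6], [7]} \<noteq> {}"
    and D5: "D \<inter> {[1], [4], [5], [6]} \<noteq> {}"
    using D[unfolded dominates_on_def, THEN conjunct2, rule_format, of "[2]"]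
      D[unfolded dominates_on_def, THEN conjunct2, rule_format, of "[3]"]
      D[unfolded dominates_on_def, THEN conjunct2, rule_format, of "[5]"]
    by (auto simp: root_and_port_simps pverts_connector_R closed_nbhd_nbrs nbrs_connector_R)
  have "finite D"
    using D by (auto simp: dominates_on_def pverts_connector_R intro: finite_subset)
  moreover have "D \<noteq> {}"
    using D2 by blast
  ultimately have "card D = 1"
    using \<open>\<not> 2 \<le> card D\<close> card_gt_0_iff[of D] by linarith
  then obtain a where "D = {a}"
    by (auto simp: card_1_singleton_iff One_nat_def)
  with D2 D3 D5 show False
    by (auto split: if_splits)
qed

text \<open>
The graph \<open>R\<close> has diameter 2.
\<close>

lemma packing_connector_R:
  assumes "nbhd_packing (rgraph connector_R) P"
  shows "card P \<le> 1"
proof -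
  have "card P \<le> 1 + card (P \<inter> {})"
    by (rule card_packing_le_if_close[OF assms])
      (simp_all add: pverts_connector_R closed_nbhd_nbrs nbrs_connector_R)
  then show ?thesis by simp
qed

section \<open>The sequence of graphs\<close>

lemma finite_seed_B: "finite (pverts (rgraph seed_B))"
  by (simp add: pverts_seed_B)

lemma finite_bowtie: "finite (pverts (rgraph (bowtie seed_B)))"
  by (simp add: pverts_bowtie pverts_seed_B)

lemma cubic_rooted_Bdot: "cubic_rooted (Bdot t)"
  by (induction t)
    (simp_all add: cubic_rooted_connector_comp cubic_connector_S cubic_connector_R
      cubic_rooted_bowtie cubic_rooted_seed_B)

lemma card_pverts_Bdot: "card (pverts (rgraph (Bdot t))) + 7 = 54 * 2 ^ t"
proof (induction t)
  case 0
  have "card (pverts (rgraph (bowtie seed_B))) = 19"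
    by (simp add: pverts_bowtie pverts_seed_B)
  then show ?case
    using finite_bowtie by (simp add: card_pverts_connector_comp pverts_connector_S)
next
  case (Suc t)
  have "finite (pverts (rgraph (Bdot t)))"
    using cubic_rooted_Bdot by (simp add: cubic_rooted_def pair_graph_iff)
  then have "card (pverts (rgraph (Bdot (Suc t)))) = 7 + card (pverts (rgraph (Bdot t))) + card (pverts (rgraph (Bdot t)))"
    by (simp add: card_pverts_connector_comp pverts_connector_R)
  with Suc.IH show ?case by simp
qed

text \<open>
The lower bound is \<open>3 + 6 + 6\<close>: a child whose root is chosen pays 1 above 6, which is exactly what
the connector can save by it. It is attained by one and the same set \<open>{b\<^sub>1, b\<^sub>3, b\<^sub>6}\<close>, used in all four
copies of the seed and in \<open>S\<close>: it dominates \<open>B\<close>, contains no end of the deleted edge, and contains the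
root, as is required in the bowties.
\<close>

lemma rigid_domination_Bdot_0: "rigid_domination (Bdot 0) 15"
proof -
  have fin: "finite (pverts (rgraph connector_S))"
    by (simp add: pverts_connector_S)
  have low: "15 \<le> card D"
    if "dominates_on (rgraph (Bdot 0)) (pverts (rgraph (Bdot 0)) - {rroot (Bdot 0)}) D" for D
    using that[unfolded Bdot.simps] fin finite_bowtie finite_bowtie
  proof (rule domination_off_root_connector_comp)
    fix D0 D1 D2
    let ?J = "bowtie seed_B"
    assume D0: "dominates_on (rgraph connector_S) (pverts (rgraph connector_S) - {rroot connector_S}
        - (if rroot ?J \<in> D1 then {port1 connector_S} else {})
        - (if rroot ?J \<in> D2 then {port2 connector_S} else {})) D0"
      and D12: "dominates_on (rgraph ?J) (pverts (rgraph ?J) - {rroot ?J}) D1"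
        "dominates_on (rgraph ?J) (pverts (rgraph ?J) - {rroot ?J}) D2"
      and card: "card D = card D0 + card D1 + card D2"
    show ?thesis
      using domination_off_root_connector_S[OF D0] card
        domination_off_root_bowtie[OF D12(1) finite_seed_B domination_off_root_seed_B]
        domination_off_root_bowtie[OF D12(2) finite_seed_B domination_off_root_seed_B]
      by linarith
  qed
  define E where "E = (\<lambda>v. 0 # 0 # v) ` {[1], [3], [6 :: nat]} \<union> (\<lambda>v. 1 # 0 # v) ` {[1], [3], [6]}"
  have J: "dominates_on (rgraph (bowtie seed_B)) (pverts (rgraph (bowtie seed_B))) E"
    unfolding E_def
    by (rule domination_bowtie)
      (simp_all add: dominates_on_def root_and_port_simps pverts_seed_B closed_nbhd_nbrs nbrs_seed_B)
  have S: "dominates_on (rgraph connector_S) (pverts (rgraph connector_S)) {[1], [3], [6]}"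
    by (simp add: dominates_on_def pverts_connector_S closed_nbhd_nbrs nbrs_connector_S)
  have dom: "dominates_on (rgraph (Bdot 0)) (pverts (rgraph (Bdot 0)))
      ((#) 0 ` {[1], [3], [6]} \<union> (#) 1 ` E \<union> (#) 2 ` E)"
    unfolding Bdot.simps by (rule domination_connector_comp[OF S J J])
  have card: "card ((#) 0 ` {[1], [3], [6]} \<union> (#) 1 ` E \<union> (#) 2 ` E) = 15"
    by (subst card_Un_copies3) (simp_all add: E_def)
  show ?thesis
    by (rule rigid_dominationI[OF low dom card])
qed

text \<open>
A chosen port gains 1 in the connector and costs its child the surplus of 1, so a packing has
at most \<open>1 + 3 + 3\<close> vertices. For equality take \<open>b\<^sub>2\<close> in \<open>S\<close>, which is neither the root nor close to a
port, and in each bowtie \<open>{b\<^sub>1, b\<^sub>4}\<close> in one copy of the seed and \<open>{b\<^sub>4}\<close> in the other.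
\<close>

lemma rigid_packing_Bdot_0: "rigid_packing (Bdot 0) 7"
proof -
  let ?J = "bowtie seed_B"
  have fin: "finite (pverts (rgraph connector_S))"
    by (simp add: pverts_connector_S)
  have root: "rroot ?J \<in> pverts (rgraph ?J)"
    by (simp add: pverts_bowtie rroot_bowtie)
  have J: "card P \<le> 2 * 1 + of_bool (P \<inter> closed_nbhd (rgraph ?J) (rroot ?J) \<noteq> {})"
    if "nbhd_packing (rgraph ?J) P" for P
    by (rule packing_bowtie_le[OF that finite_seed_B _ packing_seed_B])
      (simp add: pverts_seed_B root_and_port_simps)
  have up: "card P \<le> 7" if "nbhd_packing (rgraph (Bdot 0)) P" for P
    using that[unfolded Bdot.simps] fin finite_bowtie finite_bowtie root root
  proof (rule packing_connector_compE)
    fix P0 P1 P2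
    assume P: "nbhd_packing (rgraph connector_S) P0" "nbhd_packing (rgraph ?J) P1" "nbhd_packing (rgraph ?J) P2"
      and ports: "port1 connector_S \<in> P0 \<Longrightarrow> P1 \<inter> closed_nbhd (rgraph ?J) (rroot ?J) = {}"
        "port2 connector_S \<in> P0 \<Longrightarrow> P2 \<inter> closed_nbhd (rgraph ?J) (rroot ?J) = {}"
      and card: "card P = card P0 + card P1 + card P2"
    have "of_bool (port1 connector_S \<in> P0) + of_bool (P1 \<inter> closed_nbhd (rgraph ?J) (rroot ?J) \<noteq> {}) \<le> (1 :: nat)"
      "of_bool (port2 connector_S \<in> P0) + of_bool (P2 \<inter> closed_nbhd (rgraph ?J) (rroot ?J) \<noteq> {}) \<le> (1 :: nat)"
      using ports by auto
    with packing_connector_S[OF P(1)] J[OF P(2)] J[OF P(3)] card show ?thesis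
      by linarith
  qed
  define Q where "Q = (\<lambda>v. 0 # 0 # v) ` {[1], [4 :: nat]} \<union> (\<lambda>v. 1 # 0 # v) ` {[4]}"
  have Q: "nbhd_packing (rgraph ?J) Q"
    unfolding Q_def
    by (rule packing_bowtie) (auto simp: nbhd_packing_def root_and_port_simps pverts_seed_B closed_nbhd_nbrs nbrs_seed_B)
  have S: "nbhd_packing (rgraph connector_S) {[2]}"
    by (simp add: nbhd_packing_def pverts_connector_S)
  have nbhd_packing: "nbhd_packing (rgraph (Bdot 0)) ((#) 0 ` {[2]} \<union> (#) 1 ` Q \<union> (#) 2 ` Q)"
    unfolding Bdot.simps
    by (rule packing_connector_comp[OF S Q Q])
      (simp_all add: root_and_port_simps closed_nbhd_nbrs nbrs_connector_S)
  have card: "card ((#) 0 ` {[2]} \<union> (#) 1 ` Q \<union> (#) 2 ` Q) = 7"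
    by (subst card_Un_copies3) (simp_all add: Q_def)
  have root': "rroot (Bdot 0) \<notin> (#) 0 ` {[2]} \<union> (#) 1 ` Q \<union> (#) 2 ` Q"
    by (auto simp: rroot_connector_comp root_and_port_simps)
  show ?thesis
    by (rule rigid_packingI[OF up nbhd_packing root' card])
qed

text \<open>
Excusing both ports of \<open>R\<close> is the most that the children can do for the connector, and by rigidity
they do it at no loss; the bound 2 for \<open>R\<close> holds all the same. The set
\<open>{a\<^sub>2, a\<^sub>5}\<close> attains it without any help from the children.
\<close>

lemma rigid_domination_connector_R:
  assumes H: "cubic_rooted H" and k: "rigid_domination H k"
  shows "rigid_domination (connector_comp connector_R H H) (2 * k + 2)"
proof -
  have fin: "finite (pverts (rgraph connector_R))" "finite (pverts (rgraph H))"
    using H by (simp_all add: cubic_rooted_def pair_graph_iff pverts_connector_R)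
  obtain D where D: "dominates_on (rgraph H) (pverts (rgraph H)) D" "card D = k"
    and low: "\<And>D. dominates_on (rgraph H) (pverts (rgraph H) - {rroot H}) D \<Longrightarrow> k \<le> card D"
    using k by (auto simp: rigid_domination_def)
  have low': "2 * k + 2 \<le> card D'"
    if "dominates_on (rgraph (connector_comp connector_R H H))
        (pverts (rgraph (connector_comp connector_R H H)) - {rroot (connector_comp connector_R H H)}) D'" for D'
    using that fin(1,2,2)
  proof (rule domination_off_root_connector_comp)
    fix D0 D1 D2
    assume D0: "dominates_on (rgraph connector_R) (pverts (rgraph connector_R) - {rroot connector_R}
        - (if rroot H \<in> D1 then {port1 connector_R} else {})
        - (if rroot H \<in> D2 then {port2 connector_R} else {})) D0"
      and D12: "dominates_on (rgraph H) (pverts (rgraph H) - {rroot H}) D1"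
        "dominates_on (rgraph H) (pverts (rgraph H) - {rroot H}) D2"
      and card: "card D' = card D0 + card D1 + card D2"
    have "2 \<le> card D0"
      by (rule domination_off_root_connector_R) (use D0 in \<open>auto simp: dominates_on_def split: if_splits\<close>)
    with low[OF D12(1)] low[OF D12(2)] card show ?thesis by simp
  qed
  have dom: "dominates_on (rgraph connector_R) (pverts (rgraph connector_R)) {[2], [5]}"
    by (simp add: dominates_on_def pverts_connector_R closed_nbhd_nbrs nbrs_connector_R)
  have card: "card ((#) 0 ` {[2], [5]} \<union> (#) 1 ` D \<union> (#) 2 ` D) = 2 * k + 2"
    using D fin by (subst card_Un_copies3) (auto simp: dominates_on_def intro: finite_subset)
  show ?thesis
    by (rule rigid_dominationI[OF low' domination_connector_comp[OF dom D(1) D(1)] card])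
qed

text \<open>
The vertex \<open>a\<^sub>2\<close> is neither the root nor close to a port, so it can be added to arbitrary packings
of the two children.
\<close>

lemma rigid_packing_connector_R:
  assumes H: "cubic_rooted H" and m: "rigid_packing H m"
  shows "rigid_packing (connector_comp connector_R H H) (2 * m + 1)"
proof -
  have fin: "finite (pverts (rgraph connector_R))" "finite (pverts (rgraph H))"
    and root: "rroot H \<in> pverts (rgraph H)"
    using H by (simp_all add: cubic_rooted_def pair_graph_iff pverts_connector_R)
  obtain P where P: "nbhd_packing (rgraph H) P" "card P = m"
    and up: "\<And>P. nbhd_packing (rgraph H) P \<Longrightarrow> card P \<le> m"
    using m by (auto simp: rigid_packing_def)
  have up': "card P' \<le> 2 * m + 1" if "nbhd_packing (rgraph (connector_comp connector_R H H)) P'" for P'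
    using that fin(1,2,2) root root
  proof (rule packing_connector_compE)
    fix P0 P1 P2
    assume "nbhd_packing (rgraph connector_R) P0" "nbhd_packing (rgraph H) P1" "nbhd_packing (rgraph H) P2"
      and card: "card P' = card P0 + card P1 + card P2"
    then have "card P0 \<le> 1" "card P1 \<le> m" "card P2 \<le> m"
      using packing_connector_R up by blast+
    with card show ?thesis by simp
  qed
  have R: "nbhd_packing (rgraph connector_R) {[2]}"
    by (simp add: nbhd_packing_def pverts_connector_R)
  have nbhd_packing: "nbhd_packing (rgraph (connector_comp connector_R H H)) ((#) 0 ` {[2]} \<union> (#) 1 ` P \<union> (#) 2 ` P)"
    by (rule packing_connector_comp[OF R P(1) P(1)])
      (simp_all add: root_and_port_simps closed_nbhd_nbrs nbrs_connector_R)
  have card: "card ((#) 0 ` {[2]} \<union> (#) 1 ` P \<union> (#) 2 ` P) = 2 * m + 1"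
    using P fin by (subst card_Un_copies3) (auto simp: nbhd_packing_def intro: finite_subset)
  have root': "rroot (connector_comp connector_R H H) \<notin> (#) 0 ` {[2]} \<union> (#) 1 ` P \<union> (#) 2 ` P"
    by (auto simp: rroot_connector_comp root_and_port_simps)
  show ?thesis
    by (rule rigid_packingI[OF up' nbhd_packing root' card])
qed

lemma rigid_domination_Bdot: "rigid_domination (Bdot t) (17 * 2 ^ t - 2)"
proof (induction t)
  case 0
  show ?case using rigid_domination_Bdot_0 by simp
next
  case (Suc t)
  have "(1 :: nat) \<le> 2 ^ t"
    by simp
  then have "2 * (17 * 2 ^ t - 2) + 2 = 17 * 2 ^ Suc t - (2 :: nat)"
    unfolding power_Suc by linarith
  then show ?case
    using rigid_domination_connector_R[OF cubic_rooted_Bdot Suc] by simp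
qed

lemma rigid_packing_Bdot: "rigid_packing (Bdot t) (8 * 2 ^ t - 1)"
proof (induction t)
  case 0
  show ?case using rigid_packing_Bdot_0 by simp
next
  case (Suc t)
  have "(1 :: nat) \<le> 2 ^ t"
    by simp
  then have "2 * (8 * 2 ^ t - 1) + 1 = 8 * 2 ^ Suc t - (1 :: nat)"
    unfolding power_Suc by linarith
  then show ?case
    using rigid_packing_connector_R[OF cubic_rooted_Bdot Suc] by simp
qed

theorem theorem4p6:
  shows "(\<forall>t. pair_graph (Bhat t)
            \<and> Digraph_Component.connected (with_proj (Bhat t))
            \<and> cubic (Bhat t)
            \<and> int (card (pverts (Bhat t))) = 108 * 2 ^ t - 14
            \<and> int (domination_number (Bhat t)) = 34 * 2 ^ t - 4
            \<and> int (packing_number (Bhat t)) = 16 * 2 ^ t - 2)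
       \<and> (\<forall>t. int (domination_number (Bhat t)) - 2 * int (packing_number (Bhat t)) = 2 ^ (t + 1))
       \<and> (\<forall>t. real (domination_number (Bhat t)) / real (packing_number (Bhat t))
              = 17 / 8 + 1 / (64 * 2 ^ t - 8))
       \<and> (\<lambda>t. real (domination_number (Bhat t)) / real (packing_number (Bhat t)))
            \<longlonglongrightarrow> 17 / 8"
proof -
  have graph: "pair_graph (Bhat t)" "Digraph_Component.connected (with_proj (Bhat t))" "cubic (Bhat t)" for t
    using closure_graph_cubic[OF cubic_rooted_Bdot] by (simp_all add: Bhat_def)
  have fin: "finite (pverts (rgraph (Bdot t)))" for t
    using cubic_rooted_Bdot by (simp add: cubic_rooted_def pair_graph_iff)
  have "card (pverts (Bhat t)) = 2 * card (pverts (rgraph (Bdot t)))" for t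
    using fin by (simp add: Bhat_def pverts_closure_graph card_Un_copies)
  then have order: "int (card (pverts (Bhat t))) = 108 * 2 ^ t - 14" for t
    using arg_cong[OF card_pverts_Bdot[of t], of int] by simp
  have pow: "int (17 * 2 ^ t - 2) = 17 * 2 ^ t - 2" "int (8 * 2 ^ t - 1) = 8 * 2 ^ t - 1" for t
  proof -
    have "(1 :: nat) \<le> 2 ^ t"
      by simp
    then have "2 \<le> (17 * 2 ^ t :: nat)" "1 \<le> (8 * 2 ^ t :: nat)"
      by linarith+
    then show "int (17 * 2 ^ t - 2) = 17 * 2 ^ t - 2" "int (8 * 2 ^ t - 1) = 8 * 2 ^ t - 1"
      by (simp_all add: of_nat_diff)
  qed
  have gamma: "int (domination_number (Bhat t)) = 34 * 2 ^ t - 4" for t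
    using domination_number_closure_graph[OF fin rigid_domination_Bdot, of t] pow(1)[of t]
    by (simp add: Bhat_def)
  have rho: "int (packing_number (Bhat t)) = 16 * 2 ^ t - 2" for t
    using packing_number_closure_graph[OF cubic_rooted_Bdot rigid_packing_Bdot, of t] pow(2)[of t]
    by (simp add: Bhat_def)
  have ratio: "real (domination_number (Bhat t)) / real (packing_number (Bhat t))
      = 17 / 8 + 1 / (64 * 2 ^ t - 8)" for t
  proof -
    have "real (domination_number (Bhat t)) = 34 * 2 ^ t - 4" "real (packing_number (Bhat t)) = 16 * 2 ^ t - 2"
      using arg_cong[OF gamma[of t], of real_of_int] arg_cong[OF rho[of t], of real_of_int] by simp_all
    then have "real (domination_number (Bhat t)) / real (packing_number (Bhat t))
        = (34 * 2 ^ t - 4) / (16 * 2 ^ t - 2)"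
      by (simp only:)
    also have "\<dots> = 17 / 8 + 1 / (64 * 2 ^ t - 8)"
    proof -
      have "(1 :: real) \<le> 2 ^ t"
        by simp
      then have "16 * 2 ^ t - 2 \<noteq> (0 :: real)" "64 * 2 ^ t - 8 \<noteq> (0 :: real)"
        by linarith+
      then show ?thesis
        by (simp add: divide_simps) (simp add: algebra_simps)
    qed
    finally show ?thesis .
  qed
  have "(\<lambda>t. 1 / (64 * 2 ^ t - 8) :: real) \<longlonglongrightarrow> 0"
  proof (rule tendsto_sandwich)
    have bounds: "0 \<le> 1 / (64 * 2 ^ t - 8 :: real) \<and> 1 / (64 * 2 ^ t - 8 :: real) \<le> (1 / 2) ^ t" for t
    proof -
      have "(1 :: real) \<le> 2 ^ t"
        by simp
      then have le: "2 ^ t \<le> (64 * 2 ^ t - 8 :: real)" and pos: "0 < (2 ^ t :: real)"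
        by linarith+
      have "1 / (64 * 2 ^ t - 8) \<le> (1 :: real) / 2 ^ t"
        by (rule frac_le[OF zero_le_one order_refl pos le])
      moreover have "0 \<le> 64 * 2 ^ t - (8 :: real)"
        using le pos by linarith
      ultimately show ?thesis
        by (simp only: power_one_over zero_le_divide_1_iff simp_thms)
    qed
    then show "\<forall>\<^sub>F t in sequentially. 0 \<le> 1 / (64 * 2 ^ t - 8 :: real)"
      "\<forall>\<^sub>F t in sequentially. 1 / (64 * 2 ^ t - 8 :: real) \<le> (1 / 2) ^ t"
      by simp_all
  qed (simp_all add: LIMSEQ_realpow_zero)
  then have "(\<lambda>t. 17 / 8 + 1 / (64 * 2 ^ t - 8) :: real) \<longlonglongrightarrow> 17 / 8"
    using tendsto_add[OF tendsto_const[of "17 / 8"]] by fastforce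
  then have lim: "(\<lambda>t. real (domination_number (Bhat t)) / real (packing_number (Bhat t))) \<longlonglongrightarrow> 17 / 8"
    by (simp only: ratio)
  have diff: "int (domination_number (Bhat t)) - 2 * int (packing_number (Bhat t)) = 2 ^ (t + 1)" for t
    by (simp add: gamma rho power_add)
  show ?thesis
    by (intro conjI allI) (rule graph order gamma rho diff ratio lim)+
qed

end
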